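(* Let $\Phi : \mathscr{S} \ni s \mapsto A_s \in \mathscr{L}(X)$ and $\Psi : \mathscr{S} \ni s \mapsto B_s \in \mathscr{L}(Y)$ be two homomorphisms of a strongly [resp. weakly] right amenable SGT $\mathscr{S}$ into $\mathscr{L}(X)$ and $\mathscr{L}(Y)$, where $X$ and $Y$ are Banach spaces. Suppose $T_0 : E \to Y$ is a bounded linear operator from a closed linear subspace $E$ of $X$ into $Y$ and: (i0) $\Phi$ and $\Psi$ are continuous in the strong operator topologies [resp. operator norm topologies] of $\mathscr{L}(X)$ and $\mathscr{L}(Y)$, respectively; (i1) for any $s \in \mathscr{S}$, $A_s(E) \subset E$ and $B_s$ is an isomorphism; (i2) $Y$ is a dual Banach space; (i3) for any $s \in \mathscr{S}$, $B_s$ is weak* continuous on the closed unit ball $B_Y$ of $Y$; (i4) the function $\mathscr{S} \ni s \mapsto \|B_s^{-1}\| \in \mathbb{R}$ is locally bounded; (i5) $B_s T_0 = T_0 A_s|_E$ for any $s \in \mathscr{S}$. If, in addition, $\sup_{s\in\mathscr{S}} (\|B_s^{-1}\| \cdot \|A_s\|) < \infty$, then $T_0$ extends to a bounded linear operator $T : X \to Y$ intertwining $\Phi$ and $\Psi$ (that is, $B_s T = T A_s$ for all $s\in\mathscr{S}$) if and only if $T_0$ extends to a bounded linear operator from $X$ into $Y$. (The statement consists of two versions: "strongly / strong operator topologies" and "weakly / operator norm topologies".)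
   Context: An SGT (semigroup with topology) is a non-empty semigroup $\mathscr{S}$ that is also a (possibly non-Hausdorff) topological space; no compatibility between the multiplication and the topology is assumed. For $f:\mathscr{S}\to\mathbb{R}$ and $s\in\mathscr{S}$ let $f_s(t)=f(ts)$. $C_b(\mathscr{S})$ is the space of bounded continuous real-valued functions on $\mathscr{S}$ with the sup-norm, and $C_r(\mathscr{S})=\{f\in C_b(\mathscr{S}): f_s \text{ is continuous for every } s\in\mathscr{S}\}$. Let $C_{norm}(\mathscr{S})$ [resp. $C_{weak}(\mathscr{S})$] be the set of all $f\in C_r(\mathscr{S})$ such that $s\mapsto f_s$ and, for all $t\in\mathscr{S}$, $s\mapsto f_{st}$ are continuous from $\mathscr{S}$ to $C_r(\mathscr{S})$ equipped with its norm [resp. weak] topology. A mean on a linear subspace $\mathscr{F}$ of $C_r(\mathscr{S})$ is a linear functional $\phi:\mathscr{F}\to\mathbb{R}$ with $\inf f(\mathscr{S})\leqslant\phi(f)\leqslant\sup f(\mathscr{S})$ for all $f\in\mathscr{F}$; if $\mathscr{F}$ is right invariant ($f_s\in\mathscr{F}$ for $f\in\mathscr{F}$, $s\in\mathscr{S}$), the mean is right invariant if $\phi(f_s)=\phi(f)$ for all $f\in\mathscr{F}$, $s\in\mathscr{S}$. $\mathscr{S}$ is weakly [resp. strongly] right amenable if there is a right invariant mean on $C_{norm}(\mathscr{S})$ [resp. $C_{weak}(\mathscr{S})$]. Banach spaces are real or complex. $\mathscr{L}(X)$ is the algebra of bounded linear operators on $X$; $s\mapsto T_s$ is a homomorphism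 if $T_{st}=T_sT_t$ for all $s,t$. A dual Banach space is a Banach space linearly isometric to the dual of some Banach space; its weak* topology comes from this (fixed) identification. "$B_s$ is an isomorphism" means it is a bounded linear bijection of $Y$ with bounded inverse. *)

theory Defs
  imports "HOL-Analysis.Analysis"
begin

section \<open>Function spaces on a semigroup with topology\<close>

text \<open>
  A semigroup with topology is a type of sort \<open>{semigroup_mult, topological_space}\<close>; no axiom
  relates multiplication and topology, and no separation is assumed.  The space of bounded
  continuous real functions with the sup-norm is the library type \<open>'s \<Rightarrow>\<^sub>C real\<close>.
\<close>

text \<open>
  The function \<open>f\<^sub>s(t) = f(ts)\<close>.  It need not be continuous, so this is meaningful only if
  \<open>f\<^sub>s\<close> is again bounded and continuous, in particular for \<open>f \<in> C_r\<close>; see \<open>apply_translate\<close>.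
\<close>
definition translate ::
  "'s::{semigroup_mult,topological_space} \<Rightarrow> ('s \<Rightarrow>\<^sub>C real) \<Rightarrow> ('s \<Rightarrow>\<^sub>C real)"
  where "translate s f = Bcontfun (\<lambda>t. apply_bcontfun f (t * s))"

definition C_r :: "('s::{semigroup_mult,topological_space} \<Rightarrow>\<^sub>C real) set"
  where "C_r = {f. \<forall>s. continuous_on UNIV (\<lambda>t. apply_bcontfun f (t * s))}"

text \<open>Linear and bounded linear maps defined on a subspace \<open>E\<close>; values off \<open>E\<close> are irrelevant.\<close>

definition linear_map_on ::
  "('k \<Rightarrow> 'a \<Rightarrow> 'a) \<Rightarrow> ('k \<Rightarrow> 'b \<Rightarrow> 'b) \<Rightarrow> 'a::ab_group_add set \<Rightarrow> ('a \<Rightarrow> 'b::ab_group_add) \<Rightarrow> bool"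
  where "linear_map_on scaleA scaleB E f \<longleftrightarrow>
    (\<forall>x\<in>E. \<forall>y\<in>E. f (x + y) = f x + f y) \<and> (\<forall>c. \<forall>x\<in>E. f (scaleA c x) = scaleB c (f x))"

definition bounded_linear_map_on ::
  "('k \<Rightarrow> 'a \<Rightarrow> 'a) \<Rightarrow> ('k \<Rightarrow> 'b \<Rightarrow> 'b) \<Rightarrow> 'a::real_normed_vector set
    \<Rightarrow> ('a \<Rightarrow> 'b::real_normed_vector) \<Rightarrow> bool"
  where "bounded_linear_map_on scaleA scaleB E f \<longleftrightarrow>
    linear_map_on scaleA scaleB E f \<and> (\<exists>K. \<forall>x\<in>E. norm (f x) \<le> K * norm x)"

text \<open>The weak topology of a real linear subspace \<open>W\<close>, induced by the dual of \<open>W\<close> itself.\<close>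
definition weak_topology_on :: "'a::real_normed_vector set \<Rightarrow> 'a topology"
  where "weak_topology_on W = topology_generated_by
    {{x \<in> W. \<phi> x \<in> U} | (\<phi> :: 'a \<Rightarrow> real) U.
       bounded_linear_map_on scaleR scaleR W \<phi> \<and> open U}"

definition C_translates ::
  "('s \<Rightarrow>\<^sub>C real) topology \<Rightarrow> ('s::{semigroup_mult,topological_space} \<Rightarrow>\<^sub>C real) set"
  where "C_translates \<tau> = {f \<in> C_r.
    continuous_map euclidean \<tau> (\<lambda>s. translate s f) \<and>
    (\<forall>t. continuous_map euclidean \<tau> (\<lambda>s. translate (s * t) f))}"

definition C_norm :: "('s::{semigroup_mult,topological_space} \<Rightarrow>\<^sub>C real) set"
  where "C_norm = C_translates (top_of_set C_r)"

definition C_weak :: "('s::{semigroup_mult,topological_space} \<Rightarrow>\<^sub>C real) set"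
  where "C_weak = C_translates (weak_topology_on C_r)"

lemma apply_translate:
  assumes "f \<in> C_r"
  shows "apply_bcontfun (translate s f) = (\<lambda>t. apply_bcontfun f (t * s))"
proof -
  have "bounded (range (\<lambda>t. apply_bcontfun f (t * s)))"
    by (rule bounded_subset[OF bounded_apply_bcontfun[of f]]) auto
  with assms have "(\<lambda>t. apply_bcontfun f (t * s)) \<in> bcontfun"
    by (auto simp: bcontfun_def C_r_def)
  thus ?thesis by (simp add: translate_def Bcontfun_inverse)
qed

lemma translate_in_C_r: "f \<in> C_r \<Longrightarrow> translate s f \<in> C_r"
  by (auto simp: C_r_def apply_translate mult.assoc)

lemma translate_translate: "f \<in> C_r \<Longrightarrow> translate u (translate s f) = translate (u * s) f"
  by (rule bcontfun_eqI) (simp add: apply_translate translate_in_C_r mult.assoc)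

lemma translate_in_C_translates: "f \<in> C_translates \<tau> \<Longrightarrow> translate s f \<in> C_translates \<tau>"
  by (auto simp: C_translates_def translate_in_C_r translate_translate mult.assoc)


section \<open>Amenability\<close>

definition mean_on :: "('s \<Rightarrow>\<^sub>C real) set \<Rightarrow> (('s::topological_space \<Rightarrow>\<^sub>C real) \<Rightarrow> real) \<Rightarrow> bool"
  where "mean_on F \<phi> \<longleftrightarrow> linear_map_on scaleR scaleR F \<phi> \<and>
    (\<forall>f\<in>F. (INF t. apply_bcontfun f t) \<le> \<phi> f \<and> \<phi> f \<le> (SUP t. apply_bcontfun f t))"

definition right_invariant_mean_on ::
  "('s \<Rightarrow>\<^sub>C real) set \<Rightarrow> (('s::{semigroup_mult,topological_space} \<Rightarrow>\<^sub>C real) \<Rightarrow> real) \<Rightarrow> bool"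
  where "right_invariant_mean_on F \<phi> \<longleftrightarrow>
    mean_on F \<phi> \<and> (\<forall>f\<in>F. \<forall>s. \<phi> (translate s f) = \<phi> f)"

definition weakly_right_amenable :: "'s::{semigroup_mult,topological_space} itself \<Rightarrow> bool"
  where "weakly_right_amenable _ \<longleftrightarrow>
    (\<exists>\<phi>. right_invariant_mean_on (C_norm :: ('s \<Rightarrow>\<^sub>C real) set) \<phi>)"

definition strongly_right_amenable :: "'s::{semigroup_mult,topological_space} itself \<Rightarrow> bool"
  where "strongly_right_amenable _ \<longleftrightarrow>
    (\<exists>\<phi>. right_invariant_mean_on (C_weak :: ('s \<Rightarrow>\<^sub>C real) set) \<phi>)"


section \<open>Real and complex Banach spaces\<close>

text \<open>
  The scalar field is a type \<open>'k\<close> of sort \<open>{real_normed_field, euclidean_space}\<close>.  Both \<open>real\<close>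
  and \<open>complex\<close> are instances, and they are the only ones up to isometric isomorphism (a
  finite-dimensional commutative real division algebra with multiplicative norm).  A Banach space
  over \<open>'k\<close> is a type of class \<open>banach\<close> with a compatible scalar multiplication by \<open>'k\<close>; for
  \<open>'k = real\<close> compatibility forces \<open>scale = scaleR\<close>.
\<close>
locale banach_space_over = vector_space scale
  for scale :: "'k::{real_normed_field,euclidean_space} \<Rightarrow> 'x::banach \<Rightarrow> 'x" +
  assumes scale_of_real: "scale (of_real r) x = r *\<^sub>R x"
    and norm_scale: "norm (scale c x) = norm c * norm x"

text \<open>
  Bounded operators are elements of \<open>'x \<Rightarrow>\<^sub>L 'y\<close> (bounded and real linear, with the operator norm)
  that are linear over \<open>'k\<close>.
\<close>
definition bounded_operators ::
  "('k::field \<Rightarrow> 'x \<Rightarrow> 'x) \<Rightarrow> ('k \<Rightarrow> 'y \<Rightarrow> 'y)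
    \<Rightarrow> ('x::real_normed_vector \<Rightarrow>\<^sub>L 'y::real_normed_vector) set"
  where "bounded_operators scaleX scaleY = {T. Vector_Spaces.linear scaleX scaleY (blinfun_apply T)}"

text \<open>\<open>J\<close> is a linear isometry of \<open>Y\<close> onto the dual of the Banach space \<open>V\<close>.\<close>
definition dual_identification ::
  "('k \<Rightarrow> 'y \<Rightarrow> 'y) \<Rightarrow> ('k \<Rightarrow> 'v \<Rightarrow> 'v)
    \<Rightarrow> ('y::banach \<Rightarrow> ('v::banach \<Rightarrow>\<^sub>L 'k::{real_normed_field,euclidean_space})) \<Rightarrow> bool"
  where "dual_identification scaleY scaleV J \<longleftrightarrow>
    banach_space_over scaleV \<and>
    (\<forall>x y. J (x + y) = J x + J y) \<and>
    (\<forall>c y v. blinfun_apply (J (scaleY c y)) v = c * blinfun_apply (J y) v) \<and>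
    (\<forall>y. norm (J y) = norm y) \<and>
    range J = bounded_operators scaleV (*)"

text \<open>
  The strong operator topology on functionals is that of pointwise convergence on \<open>V\<close>, i.e. the
  weak* topology; here it is transported to \<open>Y\<close> along \<open>J\<close>.
\<close>
definition weak_star_topology ::
  "('y \<Rightarrow> ('v::real_normed_vector \<Rightarrow>\<^sub>L 'k::real_normed_vector)) \<Rightarrow> 'y topology"
  where "weak_star_topology J = pullback_topology UNIV J strong_operator_topology"

definition isomorphism :: "('y::real_normed_vector \<Rightarrow>\<^sub>L 'y) \<Rightarrow> bool"
  where "isomorphism B \<longleftrightarrow>
    bij (blinfun_apply B) \<and> bounded_linear (inv (blinfun_apply B))"

definition inverse_norm :: "('y::real_normed_vector \<Rightarrow>\<^sub>L 'y) \<Rightarrow> real"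
  where "inverse_norm B = onorm (inv (blinfun_apply B))"

definition locally_bounded :: "('s::topological_space \<Rightarrow> real) \<Rightarrow> bool"
  where "locally_bounded f \<longleftrightarrow> (\<forall>s. \<exists>U. open U \<and> s \<in> U \<and> bounded (f ` U))"

definition operator_homomorphism ::
  "('k::field \<Rightarrow> 'x \<Rightarrow> 'x) \<Rightarrow> ('s::semigroup_mult \<Rightarrow> ('x::real_normed_vector \<Rightarrow>\<^sub>L 'x)) \<Rightarrow> bool"
  where "operator_homomorphism scaleX A \<longleftrightarrow>
    (\<forall>s. A s \<in> bounded_operators scaleX scaleX) \<and> (\<forall>s t. A (s * t) = A s o\<^sub>L A t)"

end

theory Submission
  imports Defs
begin

text \<open>
  Only one implication has content: a bounded extension \<open>T\<^sub>1\<close> of \<open>T\<^sub>0\<close> has to be turned into an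
  intertwining one.  This is done by averaging the operators \<open>B\<^sub>t\<^sup>-\<^sup>1 T\<^sub>1 A\<^sub>t\<close>.  For \<open>x\<close> in \<open>X\<close> and \<open>v\<close> in
  the predual of \<open>Y\<close> put \<open>f\<^sub>x\<^sub>,\<^sub>v(t) = \<langle>B\<^sub>t\<^sup>-\<^sup>1 T\<^sub>1 A\<^sub>t x, v\<rangle>\<close>, a function bounded by the hypothesis on
  \<open>\<parallel>B\<^sub>s\<^sup>-\<^sup>1\<parallel> \<parallel>A\<^sub>s\<parallel>\<close>, and define \<open>T\<close> by \<open>\<langle>T x, v\<rangle> = \<phi>(f\<^sub>x\<^sub>,\<^sub>v)\<close> with an invariant mean \<open>\<phi>\<close>.
  For \<open>x\<close> in \<open>E\<close> the function is the constant \<open>\<langle>T\<^sub>0 x, v\<rangle>\<close>, so \<open>T\<close> extends \<open>T\<^sub>0\<close>, and invariance of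
  the mean becomes \<open>B\<^sub>s\<^sup>-\<^sup>1 T A\<^sub>s = T\<close> (lemma \<open>averaged_operator\<close>).

  For this the functions must belong to the space on which the mean lives.  If \<open>D\<^sub>s\<close> is an operator
  on the predual with adjoint \<open>B\<^sub>s\<^sup>-\<^sup>1\<close>, then translation by \<open>s\<close> takes \<open>f\<^sub>x\<^sub>,\<^sub>v\<close> to the function of the same
  kind at \<open>A\<^sub>s x\<close> and \<open>D\<^sub>s v\<close>, which is a bounded bilinear expression in these two vectors.  When the
  representations are norm continuous, both vectors depend norm continuously on \<open>s\<close>
  (\<open>coefficient_in_C_norm\<close>).  When they are strongly continuous, \<open>D\<^sub>s v\<close> is only weakly continuous,
  which still gives weak continuity of the translates (\<open>coefficient_in_C_weak\<close>).

  The operators \<open>D\<^sub>s\<close> come from weak* continuity on the unit ball: a linear functional on a dual space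
  that is weak* continuous on the ball is evaluation at a point of the predual
  (\<open>weak_star_small_imp_evaluation\<close>), so \<open>B\<^sub>s\<close> is an adjoint, and an operator with invertible adjoint
  is invertible (\<open>preadjoint_inverse_exists\<close>).  Both steps use the Hahn-Banach theorem, which is
  obtained from the fact that minimal sublinear functionals are linear.

  The scalar field enters only at the end.  Taking one real component of the pairing identifies
  \<open>Y\<close> isometrically with the real dual of its predual (\<open>real_duality_real_pairing\<close>), so the argument
  can be carried out over the reals; linearity of \<open>T\<close> over the scalar field follows because
  scalars can be moved across the pairing.
\<close>


section \<open>Sublinear functionals and the Hahn-Banach theorem\<close>

definition sublinear :: "('a::real_vector \<Rightarrow> real) \<Rightarrow> bool"
  where "sublinear p \<longleftrightarrow>
    (\<forall>x y. p (x + y) \<le> p x + p y) \<and> (\<forall>r\<ge>0. \<forall>x. p (r *\<^sub>R x) = r * p x)"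

lemma sublinear_zero: "sublinear p \<Longrightarrow> p 0 = 0"
  unfolding sublinear_def by (metis mult_zero_left order_refl scaleR_zero_left)

lemma sublinear_minus: "sublinear p \<Longrightarrow> - p (- x) \<le> p x"
proof -
  assume p: "sublinear p"
  then have "p (x + - x) \<le> p x + p (- x)" unfolding sublinear_def by blast
  with sublinear_zero[OF p] show ?thesis by simp
qed

lemma sublinearI:
  assumes add: "\<And>x y. p (x + y) \<le> p x + p y"
    and scale: "\<And>r x. 0 < r \<Longrightarrow> p (r *\<^sub>R x) \<le> r * p x"
    and zero: "p 0 = 0"
  shows "sublinear p"
proof -
  have "p (r *\<^sub>R x) = r * p x" if "0 < r" for r x
  proof (rule antisym)
    have "p x \<le> inverse r * p (r *\<^sub>R x)"
      using scale[of "inverse r" "r *\<^sub>R x"] that by simp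
    with that show "r * p x \<le> p (r *\<^sub>R x)" by (simp add: field_simps)
  qed (rule scale[OF that])
  with add zero show ?thesis
    unfolding sublinear_def by (auto simp: le_less)
qed

text \<open>
  The functional \<open>q\<close> is the infimal convolution \<open>q x = inf {p (x - s) + a | (s, a) \<in> R}\<close>; the
  compatibility condition says exactly that it is not \<open>-\<infinity>\<close>.  The two instances that matter are
  the graph of a linear functional on a subspace, and a single ray, which pushes \<open>p\<close> down in
  one direction.
\<close>
lemma sublinear_below_on_cone:
  fixes p :: "'a::real_vector \<Rightarrow> real"
  assumes p: "sublinear p" and R: "convex_cone R"
    and compatible: "\<And>s a. (s, a) \<in> R \<Longrightarrow> 0 \<le> p (- s) + a"
  obtains q where "sublinear q" "\<And>x. q x \<le> p x" "\<And>s a. (s, a) \<in> R \<Longrightarrow> q s \<le> a"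
proof -
  define h where "h x r = p (x - fst r) + snd r" for x r
  define q where "q x = (INF r\<in>R. h x r)" for x
  have R0: "(0, 0) \<in> R" using convex_cone_contains_0[OF R] by (simp add: zero_prod_def)
  have ne: "R \<noteq> {}" using R0 by auto
  have lower: "- p (- x) \<le> h x r" if "r \<in> R" for x r
  proof -
    have "p (- fst r) = p ((x - fst r) + (- x))" by simp
    also have "\<dots> \<le> p (x - fst r) + p (- x)" using p unfolding sublinear_def by blast
    finally show ?thesis using compatible[of "fst r" "snd r"] that unfolding h_def by simp
  qed
  have bdd: "bdd_below (h x ` R)" for x by (rule bdd_belowI2[OF lower])
  have q_le: "q x \<le> h x r" if "r \<in> R" for x r
    unfolding q_def by (rule cINF_lower[OF bdd that])
  have le_q: "c \<le> q x" if "\<And>r. r \<in> R \<Longrightarrow> c \<le> h x r" for c x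
    unfolding q_def by (rule cINF_greatest[OF ne that])
  have q0: "q 0 = 0"
  proof (rule antisym)
    show "q 0 \<le> 0" using q_le[OF R0, of 0] sublinear_zero[OF p] by (simp add: h_def)
    show "0 \<le> q 0" by (rule le_q) (use compatible in \<open>auto simp: h_def\<close>)
  qed
  have "sublinear q"
  proof (rule sublinearI)
    fix x y
    have "q (x + y) - h x r \<le> h y r'" if "r \<in> R" "r' \<in> R" for r r'
    proof -
      have "q (x + y) \<le> h (x + y) (r + r')"
        by (rule q_le) (use convex_cone_add[OF R] that in auto)
      also have "\<dots> = p ((x - fst r) + (y - fst r')) + (snd r + snd r')"
        unfolding h_def by (simp add: algebra_simps)
      also have "\<dots> \<le> p (x - fst r) + p (y - fst r') + (snd r + snd r')"
        using p unfolding sublinear_def by (intro add_right_mono) blast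
      also have "\<dots> = h x r + h y r'" unfolding h_def by simp
      finally show ?thesis by simp
    qed
    then have "q (x + y) - h x r \<le> q y" if "r \<in> R" for r using le_q that by blast
    then have "q (x + y) - q y \<le> h x r" if "r \<in> R" for r using that by (simp add: algebra_simps)
    then have "q (x + y) - q y \<le> q x" using le_q by blast
    then show "q (x + y) \<le> q x + q y" by simp
  next
    fix r :: real and x assume r: "0 < r"
    have "q (r *\<^sub>R x) / r \<le> h x k" if "k \<in> R" for k
    proof -
      have "q (r *\<^sub>R x) \<le> h (r *\<^sub>R x) (r *\<^sub>R k)"
        by (rule q_le) (use convex_cone_scaleR[OF R] that r in auto)
      also have "\<dots> = r * h x k"
        using p r unfolding h_def sublinear_def
        by (simp add: scaleR_diff_right[symmetric] distrib_left)
      finally show ?thesis using r by (simp add: field_simps)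
    qed
    then have "q (r *\<^sub>R x) / r \<le> q x" by (rule le_q)
    then show "q (r *\<^sub>R x) \<le> r * q x" using r by (simp add: field_simps)
  qed (rule q0)
  moreover have "q x \<le> p x" for x using q_le[OF R0, of x] by (simp add: h_def)
  moreover have "q s \<le> a" if "(s, a) \<in> R" for s a
    using q_le[OF that, of s] sublinear_zero[OF p] by (simp add: h_def)
  ultimately show ?thesis using that by blast
qed

lemma convex_cone_ray: "convex_cone ((\<lambda>t. t *\<^sub>R v) ` {0::real..})"
proof -
  have "convex_cone {0::real..}" by (auto simp: convex_cone_iff)
  then show ?thesis
    using convex_cone_linear_image linear_scaleR_left by blast
qed

text \<open>
  Pushing \<open>q\<close> down along the ray through \<open>(- y, - q y)\<close> yields a sublinear functional below \<open>q\<close>.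
  By minimality nothing changes, so \<open>q (- y) = - q y\<close>, and an odd sublinear functional is linear.
\<close>
lemma minimal_sublinear_is_linear:
  fixes q :: "'a::real_vector \<Rightarrow> real"
  assumes q: "sublinear q"
    and minimal: "\<And>q'. sublinear q' \<Longrightarrow> (\<And>x. q' x \<le> q x) \<Longrightarrow> q' = q"
  shows "linear q"
proof -
  have minus: "q (- y) = - q y" for y
  proof -
    define R where "R = (\<lambda>t. t *\<^sub>R (- y, - q y)) ` {0..}"
    have "convex_cone R" unfolding R_def by (rule convex_cone_ray)
    moreover have "0 \<le> q (- s) + a" if "(s, a) \<in> R" for s a
      using that q unfolding R_def sublinear_def by auto
    ultimately obtain q' where q': "sublinear q'" "\<And>x. q' x \<le> q x"
      "\<And>s a. (s, a) \<in> R \<Longrightarrow> q' s \<le> a"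
      using sublinear_below_on_cone[OF q] by metis
    have "(- y, - q y) \<in> R" unfolding R_def by (rule image_eqI[of _ _ 1]) auto
    with q' minimal have "q (- y) \<le> - q y" by metis
    with sublinear_minus[OF q, of y] show ?thesis by simp
  qed
  have add: "q (x + y) = q x + q y" for x y
  proof (rule antisym)
    have "q ((x + y) + (- y)) \<le> q (x + y) + q (- y)" using q unfolding sublinear_def by blast
    then show "q x + q y \<le> q (x + y)" using minus[of y] by simp
  qed (use q in \<open>auto simp: sublinear_def\<close>)
  have "q (r *\<^sub>R x) = r * q x" for r x
  proof (cases "0 \<le> r")
    case True
    with q show ?thesis unfolding sublinear_def by auto
  next
    case False
    then have "q ((- r) *\<^sub>R x) = (- r) * q x" using q unfolding sublinear_def by (metis neg_0_le_iff_le linear)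
    then show ?thesis using minus[of "r *\<^sub>R x"] by (simp only: scaleR_minus_left)
  qed
  with add show ?thesis by (intro linearI) auto
qed

text \<open>
  Zorn's lemma: the pointwise infimum of a chain is again sublinear, since the chain condition
  lets one member of the chain serve for both summands, and it is finite because every
  sublinear \<open>q \<le> p\<close> satisfies \<open>- p (- x) \<le> q x\<close>.
\<close>
lemma minimal_sublinear_exists:
  fixes p :: "'a::real_vector \<Rightarrow> real"
  assumes p: "sublinear p"
  obtains q where "sublinear q" "\<And>x. q x \<le> p x"
    "\<And>q'. sublinear q' \<Longrightarrow> (\<And>x. q' x \<le> q x) \<Longrightarrow> q' = q"
proof -
  define Q where "Q = {q. sublinear q \<and> q \<le> p}"
  have po: "partial_order_on Q (relation_of (\<lambda>q q'. q' \<le> q) Q)"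
    by (rule partial_order_on_relation_ofI) auto
  have "\<exists>u\<in>Q. \<forall>a\<in>C. u \<le> a" if C: "C \<in> Chains (relation_of (\<lambda>q q'. q' \<le> q) Q)" for C
  proof (cases "C = {}")
    case True
    with p show ?thesis unfolding Q_def by auto
  next
    case ne: False
    have CQ: "a \<in> Q" if "a \<in> C" for a
      using C that unfolding Chains_def relation_of_def by auto
    have total: "a \<le> b \<or> b \<le> a" if "a \<in> C" "b \<in> C" for a b
      using C that unfolding Chains_def relation_of_def by auto
    have sub: "sublinear a" if "a \<in> C" for a using CQ[OF that] unfolding Q_def by simp
    define u where "u x = (INF q\<in>C. q x)" for x
    have lower: "- p (- x) \<le> q x" if "q \<in> C" for x q
    proof -
      have "q (- x) \<le> p (- x)" using CQ[OF that] unfolding Q_def le_fun_def by auto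
      with sublinear_minus[OF sub[OF that], of x] show ?thesis by simp
    qed
    have bdd: "bdd_below ((\<lambda>q. q x) ` C)" for x by (rule bdd_belowI2[OF lower])
    have u_le: "u x \<le> q x" if "q \<in> C" for x q unfolding u_def by (rule cINF_lower[OF bdd that])
    have le_u: "c \<le> u x" if "\<And>q. q \<in> C \<Longrightarrow> c \<le> q x" for c x
      unfolding u_def by (rule cINF_greatest[OF ne that])
    have "sublinear u"
    proof (rule sublinearI)
      fix x y
      have "u (x + y) \<le> a x + b y" if ab: "a \<in> C" "b \<in> C" for a b
      proof -
        obtain c where c: "c \<in> C" "c \<le> a" "c \<le> b" using total[OF ab] ab by auto
        have "u (x + y) \<le> c (x + y)" by (rule u_le[OF c(1)])
        also have "\<dots> \<le> c x + c y" using sub[OF c(1)] unfolding sublinear_def by blast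
        also have "\<dots> \<le> a x + b y" using c unfolding le_fun_def by (intro add_mono) auto
        finally show ?thesis .
      qed
      then have "u (x + y) - a x \<le> u y" if "a \<in> C" for a
        using that by (intro le_u) (simp add: diff_le_eq add.commute[of _ "a x"])
      then have "u (x + y) - u y \<le> u x" by (intro le_u) (simp add: algebra_simps)
      then show "u (x + y) \<le> u x + u y" by simp
    next
      fix r :: real and x assume r: "0 < r"
      have "u (r *\<^sub>R x) / r \<le> q x" if "q \<in> C" for q
        using u_le[OF that, of "r *\<^sub>R x"] sub[OF that] r unfolding sublinear_def
        by (simp add: field_simps)
      then have "u (r *\<^sub>R x) / r \<le> u x" by (rule le_u)
      then show "u (r *\<^sub>R x) \<le> r * u x" using r by (simp add: field_simps)
    next
      have "(\<lambda>q. q 0) ` C = {0}" using ne sublinear_zero[OF sub] by force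
      then show "u 0 = 0" unfolding u_def by simp
    qed
    moreover have "u \<le> p"
    proof -
      obtain a where "a \<in> C" using ne by auto
      then have "u \<le> a" "a \<le> p" using u_le CQ unfolding le_fun_def Q_def by auto
      then show ?thesis by simp
    qed
    ultimately show ?thesis using u_le unfolding Q_def le_fun_def by auto
  qed
  from predicate_Zorn[OF po this] obtain m
    where m: "m \<in> Q" "\<And>a. a \<in> Q \<Longrightarrow> a \<le> m \<Longrightarrow> a = m" by blast
  show ?thesis
  proof (rule that[of m])
    show "sublinear m" "m x \<le> p x" for x using m(1) unfolding Q_def le_fun_def by auto
    fix q' assume "sublinear q'" "\<And>x. q' x \<le> m x"
    with m(1) have "q' \<in> Q" "q' \<le> m" unfolding Q_def le_fun_def by (auto intro: order_trans)
    with m(2) show "q' = m" by blast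
  qed
qed

text \<open>
  Once \<open>p\<close> has been lowered to a sublinear \<open>q\<close> obeying the bounds on the cone, any minimal
  sublinear functional below \<open>q\<close> is linear and inherits them.
\<close>
lemma hahn_banach_cone:
  fixes p :: "'a::real_vector \<Rightarrow> real"
  assumes "sublinear p" "convex_cone R"
    and "\<And>s a. (s, a) \<in> R \<Longrightarrow> 0 \<le> p (- s) + a"
  obtains g where "linear g" "\<And>x. g x \<le> p x" "\<And>s a. (s, a) \<in> R \<Longrightarrow> g s \<le> a"
proof -
  obtain q where q: "sublinear q" "\<And>x. q x \<le> p x" "\<And>s a. (s, a) \<in> R \<Longrightarrow> q s \<le> a"
    using sublinear_below_on_cone[OF assms] by metis
  obtain g where g: "sublinear g" "\<And>x. g x \<le> q x"
    "\<And>q'. sublinear q' \<Longrightarrow> (\<And>x. q' x \<le> g x) \<Longrightarrow> q' = g"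
    using minimal_sublinear_exists[OF q(1)] by metis
  have "linear g" using minimal_sublinear_is_linear[OF g(1,3)] by blast
  with g(2) q show ?thesis using that by (meson order_trans)
qed

lemma linear_le_seminorm_abs:
  fixes g p :: "'a::real_vector \<Rightarrow> real"
  assumes "linear g" "\<And>x. g x \<le> p x" "\<And>x. p (- x) = p x"
  shows "\<bar>g x\<bar> \<le> p x"
  using assms(2)[of x] assms(2)[of "- x"] assms(3)[of x] linear_neg[OF assms(1), of x] by linarith

text \<open>
  A functional below \<open>g\<close> on a subspace equals \<open>g\<close> there, as one sees at \<open>x\<close> and \<open>- x\<close>; hence
  the cone version applied to the graph of \<open>g\<close> gives an extension.
\<close>
lemma hahn_banach_extension:
  fixes g :: "'a::real_normed_vector \<Rightarrow> real"
  assumes g: "linear g" and N: "subspace N" and \<epsilon>: "0 \<le> \<epsilon>"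
    and le: "\<And>x. x \<in> N \<Longrightarrow> g x \<le> \<epsilon> * norm x"
  obtains h where "linear h" "\<And>x. x \<in> N \<Longrightarrow> h x = g x" "\<And>x. \<bar>h x\<bar> \<le> \<epsilon> * norm x"
proof -
  define p where "p x = \<epsilon> * norm x" for x :: 'a
  have p: "sublinear p"
  proof (rule sublinearI)
    show "p (x + y) \<le> p x + p y" for x y
      using mult_left_mono[OF norm_triangle_ineq[of x y] \<epsilon>] by (simp add: p_def distrib_left)
  qed (simp_all add: p_def)
  define R where "R = (\<lambda>x. (x, g x)) ` N"
  have "linear (\<lambda>x. (x, g x))" using g by (simp add: linear_iff)
  then have cone: "convex_cone R"
    unfolding R_def using N convex_cone_linear_image subspace_imp_convex_cone by blast
  have compat: "0 \<le> p (- s) + a" if "(s, a) \<in> R" for s a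
    using le[of "- s"] that N linear_neg[OF g, of s] by (auto simp: R_def p_def subspace_neg)
  obtain h where h: "linear h" "\<And>x. h x \<le> p x" "\<And>s a. (s, a) \<in> R \<Longrightarrow> h s \<le> a"
    using hahn_banach_cone[OF p cone compat] by blast
  have "h x \<le> g x" if "x \<in> N" for x using h(3) that unfolding R_def by blast
  then have "h x = g x" if "x \<in> N" for x
    using that N linear_neg[OF g, of x] linear_neg[OF h(1), of x] subspace_neg[OF N, of x]
    by (metis antisym neg_le_iff_le)
  moreover have "\<bar>h x\<bar> \<le> \<epsilon> * norm x" for x
    using linear_le_seminorm_abs[OF h(1), of p x] h(2) by (simp add: p_def)
  ultimately show ?thesis using that h(1) by blast
qed

lemma infdist_minus_subspace:
  assumes "subspace S"
  shows "infdist (- x) S = infdist x (S :: 'a::real_normed_vector set)"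
proof -
  have "infdist (- y) S \<le> infdist y S" for y
  proof -
    have ne: "S \<noteq> {}" using assms subspace_0 by auto
    have "infdist (- y) S \<le> dist y s" if "s \<in> S" for s
      using infdist_le[of "- s" S "- y"] that assms
      by (simp add: subspace_neg dist_minus)
    then show ?thesis unfolding infdist_notempty[OF ne, of y] by (rule cINF_greatest[OF ne])
  qed
  from this[of x] this[of "- x"] show ?thesis by simp
qed

lemma sublinear_infdist_subspace:
  fixes S :: "'a::real_normed_vector set"
  assumes S: "subspace S"
  shows "sublinear (\<lambda>x. infdist x S)"
proof (rule sublinearI)
  have ne: "S \<noteq> {}" using S subspace_0 by auto
  have le_inf: "c \<le> infdist x S" if "\<And>s. s \<in> S \<Longrightarrow> c \<le> dist x s" for c x
    unfolding infdist_notempty[OF ne] by (rule cINF_greatest[OF ne that])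
  fix x y
  have "infdist (x + y) S \<le> dist x s + dist y t" if "s \<in> S" "t \<in> S" for s t
    using infdist_le[of "s + t" S "x + y"] that S dist_triangle_add[of x y s t]
    by (auto simp: subspace_add)
  then have "infdist (x + y) S - dist x s \<le> infdist y S" if "s \<in> S" for s
    using that by (intro le_inf) (simp add: algebra_simps)
  then have "infdist (x + y) S - infdist y S \<le> infdist x S"
    by (intro le_inf) (simp add: algebra_simps)
  then show "infdist (x + y) S \<le> infdist x S + infdist y S" by simp
  fix r :: real assume r: "0 < r"
  have "infdist (r *\<^sub>R x) S / r \<le> dist x s" if "s \<in> S" for s
  proof -
    have "infdist (r *\<^sub>R x) S \<le> dist (r *\<^sub>R x) (r *\<^sub>R s)"
      using that S by (intro infdist_le) (simp add: subspace_scale)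
    also have "\<dots> = r * dist x s" using r by (simp add: dist_norm scaleR_diff_right[symmetric])
    finally show ?thesis using r by (simp add: field_simps)
  qed
  then have "infdist (r *\<^sub>R x) S / r \<le> infdist x S" by (rule le_inf)
  then show "infdist (r *\<^sub>R x) S \<le> r * infdist x S" using r by (simp add: field_simps)
qed (use S in \<open>simp add: subspace_0\<close>)

text \<open>
  With \<open>S = {0}\<close> this is a functional norming \<open>u\<close>; with \<open>S\<close> closed and \<open>u \<notin> S\<close> it
  separates \<open>u\<close> from \<open>S\<close>.
\<close>
lemma hahn_banach_distance:
  fixes S :: "'a::real_normed_vector set"
  assumes S: "subspace S"
  obtains \<psi> where "bounded_linear \<psi>" "\<And>x. \<bar>\<psi> x\<bar> \<le> infdist x S" "\<psi> u = infdist u S"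
proof -
  define p where "p x = infdist x S" for x
  have p: "sublinear p" unfolding p_def by (rule sublinear_infdist_subspace[OF S])
  have sym: "p (- x) = p x" for x unfolding p_def by (rule infdist_minus_subspace[OF S])
  define R where "R = (\<lambda>t. t *\<^sub>R (- u, - p u)) ` {0..}"
  have "convex_cone R" unfolding R_def by (rule convex_cone_ray)
  moreover have "0 \<le> p (- s) + a" if "(s, a) \<in> R" for s a
    using that p unfolding R_def sublinear_def by auto
  ultimately obtain g where g: "linear g" "\<And>x. g x \<le> p x" "\<And>s a. (s, a) \<in> R \<Longrightarrow> g s \<le> a"
    using hahn_banach_cone[OF p] by metis
  have "(- u, - p u) \<in> R" unfolding R_def by (rule image_eqI[of _ _ 1]) auto
  then have "g u = p u" using g(2)[of u] g(3) linear_neg[OF g(1), of u] by fastforce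
  moreover have abs: "\<bar>g x\<bar> \<le> infdist x S" for x
    using linear_le_seminorm_abs[OF g(1), of p x] g(2) sym by (simp add: p_def)
  moreover have "bounded_linear g"
  proof (rule bounded_linear_intro[where K = 1])
    show "norm (g x) \<le> norm x * 1" for x
      using abs[of x] infdist_le[of 0 S x] S by (simp add: subspace_0)
  qed (use g(1) in \<open>auto simp: linear_add linear_scale\<close>)
  ultimately show ?thesis using that by (simp add: p_def)
qed


section \<open>Weak* continuous operators on a dual space\<close>

text \<open>
  An isometry of \<open>'y\<close> onto the real dual of \<open>'v\<close>, given as a pairing.
\<close>
locale real_duality =
  fixes P :: "'y::real_normed_vector \<Rightarrow> 'v::banach \<Rightarrow> real"
  assumes bilinear: "bounded_bilinear P"
    and abs_le: "\<bar>P y v\<bar> \<le> norm y * norm v"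
    and norm_le: "0 \<le> M \<Longrightarrow> (\<And>v. \<bar>P y v\<bar> \<le> M * norm v) \<Longrightarrow> norm y \<le> M"
    and represent: "bounded_linear \<psi> \<Longrightarrow> \<exists>y. \<forall>v. \<psi> v = P y v"
begin

sublocale bounded_bilinear P by (rule bilinear)

lemma norm_predual_le:
  assumes M: "0 \<le> M" and le: "\<And>y. \<bar>P y v\<bar> \<le> M * norm y"
  shows "norm v \<le> M"
proof -
  obtain \<psi> where \<psi>: "bounded_linear \<psi>" "\<And>x. \<bar>\<psi> x\<bar> \<le> infdist x {0}" "\<psi> v = infdist v {0}"
    using hahn_banach_distance[OF subspace_single_0, of v] by blast
  then obtain y where y: "\<And>v. \<psi> v = P y v" using represent by blast
  have "norm y \<le> 1" by (rule norm_le) (use \<psi>(2) in \<open>auto simp: y[symmetric]\<close>)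
  have "norm v = P y v" using \<psi>(3) by (simp add: y)
  also have "\<dots> \<le> M * norm y" using le[of y] by simp
  also have "\<dots> \<le> M * 1" using \<open>norm y \<le> 1\<close> M by (rule mult_left_mono)
  finally show ?thesis by simp
qed

lemma predual_eqI:
  assumes "\<And>y. P y v = P y w"
  shows "v = w"
  using norm_predual_le[of 0 "v - w"] assms by (simp add: diff_right)

lemma dual_eqI:
  assumes "\<And>v. P y v = P z v"
  shows "y = z"
  using norm_le[of 0 "y - z"] assms by (simp add: diff_left)

text \<open>
  Induction on \<open>F\<close>: if some \<open>y0\<close> is killed by \<open>F\<close> but not by \<open>w\<close>, then subtracting the right
  multiple of \<open>P \<cdot> w\<close> from \<open>h\<close> gives a functional vanishing on the common kernel of \<open>F\<close> alone.
\<close>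
lemma evaluation_if_vanishes_on_kernel:
  assumes "finite F" "linear h" "\<And>y. (\<forall>w\<in>F. P y w = 0) \<Longrightarrow> h y = 0"
  shows "\<exists>v. \<forall>y. h y = P y v"
  using assms
proof (induction F arbitrary: h rule: finite_induct)
  case empty
  then show ?case by (intro exI[of _ 0]) (simp add: zero_right)
next
  case (insert w F)
  show ?case
  proof (cases "\<exists>y0. (\<forall>w'\<in>F. P y0 w' = 0) \<and> P y0 w \<noteq> 0")
    case False
    with insert show ?thesis by (metis insert_iff)
  next
    case True
    then obtain y0 where y0: "\<forall>w'\<in>F. P y0 w' = 0" "P y0 w \<noteq> 0" by blast
    define c where "c = h y0 / P y0 w"
    have "h y - c * P y w = 0" if "\<forall>w'\<in>F. P y w' = 0" for y
    proof -
      define t where "t = P y w / P y0 w"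
      have "h (y - t *\<^sub>R y0) = 0"
        by (rule insert.prems(2)) (use that y0 in \<open>auto simp: t_def diff_left scaleR_left\<close>)
      then show ?thesis
        using insert.prems(1) y0(2) by (simp add: linear_diff linear_scale t_def c_def)
    qed
    moreover have "linear (\<lambda>y. h y - c * P y w)"
      using insert.prems(1)
      by (auto simp: linear_iff add_left scaleR_left algebra_simps)
    ultimately obtain v where "\<forall>y. h y - c * P y w = P y v"
      using insert.IH by blast
    then have "\<forall>y. h y = P y (v + c *\<^sub>R w)"
      by (simp add: add_right scaleR_right algebra_simps)
    then show ?thesis by blast
  qed
qed

text \<open>
  A consequence of weak* continuity at \<open>0\<close> on the unit ball that mentions no topology: a basic
  weak* neighbourhood of \<open>0\<close> restricts finitely many coordinates, so it contains their common kernel.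
\<close>
definition weak_star_small :: "('y \<Rightarrow> real) \<Rightarrow> bool"
  where "weak_star_small g \<longleftrightarrow> (\<forall>\<epsilon>>0. \<exists>F. finite F \<and>
    (\<forall>y. norm y \<le> 1 \<longrightarrow> (\<forall>w\<in>F. P y w = 0) \<longrightarrow> \<bar>g y\<bar> \<le> \<epsilon>))"

text \<open>
  On the annihilator \<open>N\<close> of the finite set \<open>F\<close> the functional \<open>g\<close> has norm at most \<open>\<epsilon>\<close>.  If \<open>h\<close>
  extends \<open>g\<close> from \<open>N\<close> with the same bound, then \<open>g - h\<close> vanishes on \<open>N\<close> and hence is an evaluation.
\<close>
lemma near_evaluation:
  assumes g: "linear g" and small: "weak_star_small g" and \<epsilon>: "0 < \<epsilon>"
  shows "\<exists>v. \<forall>y. \<bar>g y - P y v\<bar> \<le> \<epsilon> * norm y"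
proof -
  obtain F where F: "finite F"
    "\<And>y. norm y \<le> 1 \<Longrightarrow> \<forall>w\<in>F. P y w = 0 \<Longrightarrow> \<bar>g y\<bar> \<le> \<epsilon>"
    using small \<epsilon> unfolding weak_star_small_def by blast
  define N where "N = {y. \<forall>w\<in>F. P y w = 0}"
  have N: "subspace N"
    unfolding N_def subspace_def by (simp add: zero_left add_left scaleR_left)
  have "g y \<le> \<epsilon> * norm y" if "y \<in> N" for y
  proof (cases "y = 0")
    case True
    then show ?thesis using linear_0[OF g] by simp
  next
    case False
    have "\<bar>g (y /\<^sub>R norm y)\<bar> \<le> \<epsilon>"
      by (rule F(2)) (use that False in \<open>auto simp: N_def scaleR_left\<close>)
    then have "\<bar>g y\<bar> / norm y \<le> \<epsilon>"
      using linear_scale[OF g] by (simp add: abs_mult divide_inverse mult.commute)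
    then show ?thesis using False by (simp add: pos_divide_le_eq)
  qed
  then obtain h where h: "linear h" "\<And>y. y \<in> N \<Longrightarrow> h y = g y" "\<And>y. \<bar>h y\<bar> \<le> \<epsilon> * norm y"
    using hahn_banach_extension[OF g N less_imp_le[OF \<epsilon>]] by blast
  have "\<exists>v. \<forall>y. g y - h y = P y v"
    by (rule evaluation_if_vanishes_on_kernel[OF F(1)])
      (use h(2) linear_compose_sub[OF g h(1)] in \<open>auto simp: N_def\<close>)
  then obtain v where "\<And>y. g y - h y = P y v" by blast
  then have "g y - P y v = h y" for y by (metis diff_diff_eq2 add_diff_cancel_left')
  with h(3) show ?thesis by (intro exI[of _ v]) simp
qed

text \<open>
  Evaluations at points of the predual form a closed subspace of the bidual, because the predual
  is complete and embeds isometrically; \<open>g\<close> is a limit of such evaluations.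
\<close>
lemma weak_star_small_imp_evaluation:
  assumes g: "linear g" and small: "weak_star_small g"
  shows "\<exists>v. \<forall>y. g y = P y v"
proof -
  obtain v where v: "\<And>n y. \<bar>g y - P y (v n)\<bar> \<le> inverse (real (Suc n)) * norm y"
    using near_evaluation[OF g small, of "inverse (real (Suc _))"] by (metis inverse_positive_iff_positive of_nat_0_less_iff zero_less_Suc)
  have dist: "norm (v m - v n) \<le> inverse (real (Suc m)) + inverse (real (Suc n))" for m n
  proof (rule norm_predual_le)
    fix y
    show "\<bar>P y (v m - v n)\<bar> \<le> (inverse (real (Suc m)) + inverse (real (Suc n))) * norm y"
      using v[of y m] v[of y n] by (simp add: diff_right distrib_right)
  qed (simp add: add_nonneg_nonneg)
  have "Cauchy v"
  proof (rule metric_CauchyI)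
    fix e :: real assume "0 < e"
    then obtain K where K: "inverse (real (Suc K)) < e / 2"
      using reals_Archimedean[of "e / 2"] by auto
    have "dist (v m) (v n) < e" if "m \<ge> K" "n \<ge> K" for m n
    proof -
      have "inverse (real (Suc m)) \<le> inverse (real (Suc K))"
        "inverse (real (Suc n)) \<le> inverse (real (Suc K))"
        using that by (simp_all add: le_imp_inverse_le)
      with K dist[of m n] show ?thesis unfolding dist_norm by linarith
    qed
    then show "\<exists>K. \<forall>m\<ge>K. \<forall>n\<ge>K. dist (v m) (v n) < e" by blast
  qed
  then obtain w where w: "v \<longlonglongrightarrow> w" using Cauchy_convergent convergent_def by blast
  have "g y = P y w" for y
  proof -
    have "(\<lambda>n. P y (v n)) \<longlonglongrightarrow> P y w" by (rule tendsto[OF tendsto_const w])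
    moreover have "(\<lambda>n. P y (v n)) \<longlonglongrightarrow> g y"
    proof (rule Lim_transform[OF tendsto_const])
      have "(\<lambda>n. inverse (real (Suc n)) * norm y) \<longlonglongrightarrow> 0"
        by (rule tendsto_mult_left_zero[OF LIMSEQ_inverse_real_of_nat])
      then show "(\<lambda>n. P y (v n) - g y) \<longlonglongrightarrow> 0"
        by (rule Lim_null_comparison[rotated]) (use v in \<open>auto simp: abs_minus_commute\<close>)
    qed
    ultimately show ?thesis by (rule LIMSEQ_unique[symmetric])
  qed
  then show ?thesis by blast
qed

lemma preadjoint_exists:
  fixes B :: "'y \<Rightarrow> 'y"
  assumes B: "linear B" and small: "\<And>v. weak_star_small (\<lambda>y. P (B y) v)"
  obtains C where "\<And>y v. P (B y) v = P y (C v)"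
proof -
  have "\<exists>w. \<forall>y. P (B y) v = P y w" for v
  proof (rule weak_star_small_imp_evaluation[OF _ small])
    show "linear (\<lambda>y. P (B y) v)"
      using B by (auto simp: linear_iff add_left scaleR_left)
  qed
  then show ?thesis using that by metis
qed

lemma preadjoint_linear:
  assumes "\<And>y v. P (B y) v = P y (C v)"
  shows "linear C"
proof (rule linearI)
  show "C (v + w) = C v + C w" for v w
    by (rule predual_eqI) (simp add: add_right flip: assms)
  show "C (r *\<^sub>R v) = r *\<^sub>R C v" for r v
    by (rule predual_eqI) (simp add: scaleR_right flip: assms)
qed

lemma norm_preadjoint_le:
  assumes w: "\<And>y. P (B y) v = P y w" and K: "0 \<le> K" "\<And>y. norm (B y) \<le> K * norm y"
  shows "norm w \<le> K * norm v"
proof (rule norm_predual_le)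
  fix y
  have "\<bar>P y w\<bar> \<le> norm (B y) * norm v" using abs_le[of "B y" v] by (simp add: w)
  also have "\<dots> \<le> (K * norm y) * norm v" by (intro mult_right_mono K) simp
  finally show "\<bar>P y w\<bar> \<le> K * norm v * norm y" by (simp add: mult_ac)
qed (use K in simp)

text \<open>
  The preadjoint \<open>C\<close> of \<open>B\<close> is bounded below because \<open>Bi\<close> is bounded, so its range is closed; a
  functional vanishing on the range is killed by \<open>B\<close>, hence zero, so the range is everything.
  The preadjoint of \<open>Bi\<close> is the inverse of \<open>C\<close>.
\<close>
lemma preadjoint_inverse_exists:
  fixes B Bi :: "'y \<Rightarrow> 'y"
  assumes B: "bounded_linear B" and Bi: "bounded_linear Bi"
    and inverse: "\<And>y. Bi (B y) = y" "\<And>y. B (Bi y) = y"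
    and small: "\<And>v. weak_star_small (\<lambda>y. P (B y) v)"
  obtains D where "\<And>y v. P (Bi y) v = P y (D v)"
proof -
  obtain C where C: "\<And>y v. P (B y) v = P y (C v)" 
    using preadjoint_exists[OF bounded_linear.linear[OF B] small] by blast
  note linC = preadjoint_linear[OF C]
  obtain K where K: "0 < K" "\<And>y. norm (Bi y) \<le> K * norm y"
    using bounded_linear.pos_bounded[OF Bi] by (metis mult.commute)
  have lower: "norm v \<le> K * norm (C v)" for v
  proof (rule norm_predual_le)
    fix y
    have "\<bar>P y v\<bar> = \<bar>P (Bi y) (C v)\<bar>" by (simp add: inverse flip: C)
    also have "\<dots> \<le> norm (Bi y) * norm (C v)" by (rule abs_le)
    also have "\<dots> \<le> (K * norm y) * norm (C v)" by (intro mult_right_mono K) simp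
    finally show "\<bar>P y v\<bar> \<le> K * norm (C v) * norm y" by (simp add: mult_ac)
  qed (use K in simp)
  have "bounded_linear C"
  proof -
    obtain M where M: "0 < M" "\<And>y. norm (B y) \<le> M * norm y"
      using bounded_linear.pos_bounded[OF B] by (metis mult.commute)
    have "norm (C v) \<le> M * norm v" for v
      by (rule norm_preadjoint_le[OF C]) (use M in auto)
    then show ?thesis
      using linC by (intro bounded_linear_intro[where K = M]) (auto simp: linear_add linear_scale mult.commute)
  qed
  then have "complete (range C)"
    by (rule complete_isometric_image[of "inverse K" UNIV, rotated 2])
      (use lower K in \<open>auto simp: field_simps complete_UNIV\<close>)
  then have closed: "closed (range C)" by (rule complete_imp_closed)
  have "\<exists>w. C w = u" for u
  proof (rule ccontr)
    assume "\<not> ?thesis"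
    then have u: "u \<notin> range C" by auto
    have S: "subspace (range C)" by (rule linear_subspace_image[OF linC]) simp
    obtain \<psi> where \<psi>: "bounded_linear \<psi>" "\<And>x. \<bar>\<psi> x\<bar> \<le> infdist x (range C)"
      "\<psi> u = infdist u (range C)"
      using hahn_banach_distance[OF S, of u] by blast
    then obtain y where y: "\<And>v. \<psi> v = P y v" using represent by blast
    have "P y (C v) = 0" for v using \<psi>(2)[of "C v"] by (simp add: y)
    then have "B y = 0" by (intro dual_eqI) (simp add: C zero_left)
    then have "y = 0" using inverse(1)[of y] inverse(1)[of 0] linear_simps(3)[OF B] by simp
    then have "infdist u (range C) = 0" using \<psi>(3) y[of u] by (simp add: zero_left)
    then show False using u in_closed_iff_infdist_zero[OF closed, of u] by auto
  qed
  then obtain D where D: "\<And>u. C (D u) = u" by metis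
  have "P (Bi y) v = P y (D v)" for y v
    by (metis C D inverse(2))
  then show ?thesis using that by blast
qed

end


section \<open>Averaging operators over a semigroup\<close>

lemma tendsto_zero_locally_bounded_mult:
  fixes h :: "'s::topological_space \<Rightarrow> 'a::real_normed_vector"
  assumes f: "locally_bounded f" and g: "(g \<longlongrightarrow> 0) (at r)"
    and le: "\<And>s. norm (h s) \<le> f s * norm (g s :: 'b::real_normed_vector)"
  shows "(h \<longlongrightarrow> 0) (at r)"
proof -
  obtain U where U: "open U" "r \<in> U" "bounded (f ` U)"
    using f unfolding locally_bounded_def by blast
  then obtain K where K: "\<And>s. s \<in> U \<Longrightarrow> f s \<le> K"
    unfolding bounded_real by (metis abs_le_D1 imageI)
  have "\<forall>\<^sub>F s in at r. norm (h s) \<le> K * norm (g s)"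
    unfolding eventually_at_topological
  proof (intro exI[of _ U] conjI ballI impI U(1,2))
    show "norm (h s) \<le> K * norm (g s)" if "s \<in> U" for s
      using le[of s] mult_right_mono[OF K[OF that] norm_ge_zero[of "g s"]] by simp
  qed
  moreover have "((\<lambda>s. K * norm (g s)) \<longlongrightarrow> 0) (at r)"
    using g by (intro tendsto_mult_right_zero tendsto_norm_zero)
  ultimately show ?thesis by (rule Lim_null_comparison)
qed

lemma continuous_on_UNIV_iff_null:
  fixes f :: "'s::topological_space \<Rightarrow> 'a::real_normed_vector"
  shows "continuous_on UNIV f \<longleftrightarrow> (\<forall>r. ((\<lambda>s. f s - f r) \<longlongrightarrow> 0) (at r))"
  unfolding continuous_on_def by (simp add: LIM_zero_iff)

lemma mean_on_abs_le:
  assumes \<phi>: "mean_on F \<phi>" and f: "f \<in> F"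
  shows "\<bar>\<phi> f\<bar> \<le> norm f"
proof -
  have ab: "\<bar>apply_bcontfun f t\<bar> \<le> norm f" for t using norm_bounded[of f t] by simp
  have "(SUP t. apply_bcontfun f t) \<le> norm f"
    by (rule cSUP_least) (use ab abs_le_D1 in auto)
  moreover have "- norm f \<le> (INF t. apply_bcontfun f t)"
    by (rule cINF_greatest) (use ab in \<open>auto simp: abs_le_iff minus_le_iff\<close>)
  ultimately show ?thesis using \<phi> f unfolding mean_on_def by fastforce
qed

lemma mean_on_constant:
  assumes "mean_on F \<phi>" "f \<in> F" "\<And>t. apply_bcontfun f t = c"
  shows "\<phi> f = c"
  using assms unfolding mean_on_def by fastforce

text \<open>
  \<open>Bi s\<close> stands for the inverse of \<open>B s\<close>, whence the reversed order in \<open>Bi_mult\<close>; \<open>D s\<close> is its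
  preadjoint, and \<open>T1\<close> is the bounded operator to be averaged.
\<close>
locale averaging = real_duality P
  for P :: "'y::real_normed_vector \<Rightarrow> 'v::banach \<Rightarrow> real" +
  fixes A :: "'s::{semigroup_mult,topological_space} \<Rightarrow> 'x::real_normed_vector \<Rightarrow>\<^sub>L 'x"
    and Bi :: "'s \<Rightarrow> 'y \<Rightarrow>\<^sub>L 'y"
    and D :: "'s \<Rightarrow> 'v \<Rightarrow> 'v"
    and T1 :: "'x \<Rightarrow>\<^sub>L 'y"
    and M :: real
  assumes A_mult: "A (s * t) = A s o\<^sub>L A t"
    and Bi_mult: "Bi (s * t) = Bi t o\<^sub>L Bi s"
    and preadjoint: "P (Bi s y) v = P y (D s v)"
    and uniform_bound: "norm (Bi s) * norm (A s) \<le> M"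
    and Bi_locally_bounded: "locally_bounded (\<lambda>s. norm (Bi s))"
    and A_continuous: "continuous_on UNIV (\<lambda>s. A s x)"
    and Bi_continuous: "continuous_on UNIV (\<lambda>s. Bi s y)"
begin

lemma D_mult: "D (s * t) v = D s (D t v)"
  by (rule predual_eqI) (simp add: Bi_mult flip: preadjoint)

lemma norm_D_le: "norm (D s v) \<le> norm (Bi s) * norm v"
  by (rule norm_preadjoint_le[OF preadjoint]) (auto intro: norm_blinfun)

lemma norm_D_diff_le: "norm (D s v - D r v) \<le> norm (Bi s - Bi r) * norm v"
proof -
  have "P ((Bi s - Bi r) y) v = P y (D s v - D r v)" for y
    by (simp add: blinfun.diff_left diff_left diff_right preadjoint)
  then show ?thesis by (rule norm_preadjoint_le) (auto intro: norm_blinfun)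
qed

definition coefficient :: "'x \<Rightarrow> 'v \<Rightarrow> 's \<Rightarrow>\<^sub>C real"
  where "coefficient x v = Bcontfun (\<lambda>t. P (Bi t (T1 (A t x))) v)"

text \<open>
  Inserting a continuous function into a strongly continuous, locally bounded family of operators
  gives a continuous function: the change of the argument is controlled by the local bound on
  \<open>Bi\<close>, the change of the operator by strong continuity at a fixed vector.
\<close>
lemma coefficient_continuous: "continuous_on UNIV (\<lambda>t. P (Bi t (T1 (A t x))) v)"
proof -
  have "continuous_on UNIV (\<lambda>t. Bi t (T1 (A t x)))"
    unfolding continuous_on_UNIV_iff_null
  proof
    fix r
    define z where "z t = T1 (A t x)" for t
    have z: "((\<lambda>t. z t - z r) \<longlongrightarrow> 0) (at r)"
      using bounded_linear.continuous_on[OF blinfun.bounded_linear_right A_continuous[of x], of T1]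
      unfolding continuous_on_UNIV_iff_null z_def by blast
    have "((\<lambda>t. Bi t (z t - z r)) \<longlongrightarrow> 0) (at r)"
      by (rule tendsto_zero_locally_bounded_mult[OF Bi_locally_bounded z]) (rule norm_blinfun)
    moreover have "((\<lambda>t. Bi t (z r) - Bi r (z r)) \<longlongrightarrow> 0) (at r)"
      using Bi_continuous[of "z r"] unfolding continuous_on_UNIV_iff_null by blast
    ultimately have "((\<lambda>t. Bi t (z t - z r) + (Bi t (z r) - Bi r (z r))) \<longlongrightarrow> 0) (at r)"
      by (rule tendsto_add_zero)
    then show "((\<lambda>t. Bi t (T1 (A t x)) - Bi r (T1 (A r x))) \<longlongrightarrow> 0) (at r)"
      by (simp add: z_def blinfun.diff_right)
  qed
  then show ?thesis by (rule bounded_linear.continuous_on[OF bounded_linear_left])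
qed

lemma coefficient_bound:
  "\<bar>P (Bi t (T1 (A t x))) v\<bar> \<le> M * norm T1 * norm x * norm v"
proof -
  have "norm (Bi t (T1 (A t x))) \<le> norm (Bi t) * (norm T1 * (norm (A t) * norm x))"
    by (intro order_trans[OF norm_blinfun] mult_left_mono) auto
  also have "\<dots> = (norm (Bi t) * norm (A t)) * (norm T1 * norm x)" by (simp add: mult_ac)
  also have "\<dots> \<le> M * (norm T1 * norm x)" by (intro mult_right_mono uniform_bound) simp
  finally have "norm (Bi t (T1 (A t x))) * norm v \<le> M * (norm T1 * norm x) * norm v"
    by (rule mult_right_mono) simp
  with abs_le[of "Bi t (T1 (A t x))" v] show ?thesis by (simp add: mult_ac)
qed

lemma apply_coefficient: "apply_bcontfun (coefficient x v) t = P (Bi t (T1 (A t x))) v"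
proof -
  have "(\<lambda>t. P (Bi t (T1 (A t x))) v) \<in> bcontfun"
    using coefficient_bound by (intro bcontfun_normI[OF coefficient_continuous]) auto
  then show ?thesis unfolding coefficient_def by (simp add: Bcontfun_inverse)
qed

lemma norm_coefficient_le: "norm (coefficient x v) \<le> M * norm T1 * norm x * norm v"
  by (rule norm_bound) (simp add: apply_coefficient coefficient_bound)

lemma coefficient_add_left: "coefficient (x + x') v = coefficient x v + coefficient x' v"
  by (rule bcontfun_eqI) (simp add: apply_coefficient blinfun.add_right add_left)

lemma coefficient_scaleR_left: "coefficient (r *\<^sub>R x) v = r *\<^sub>R coefficient x v"
  by (rule bcontfun_eqI) (simp add: apply_coefficient blinfun.scaleR_right scaleR_left)

lemma coefficient_add_right: "coefficient x (v + v') = coefficient x v + coefficient x v'"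
  by (rule bcontfun_eqI) (simp add: apply_coefficient add_right)

lemma coefficient_scaleR_right: "coefficient x (r *\<^sub>R v) = r *\<^sub>R coefficient x v"
  by (rule bcontfun_eqI) (simp add: apply_coefficient scaleR_right)

text \<open>
  A right translate of a coefficient is again a coefficient.  This is the reason for introducing
  \<open>D\<close>: it gives membership in \<open>C_r\<close>, the dependence of translates on \<open>s\<close>, and the intertwining
  relation for the average.
\<close>
lemma coefficient_mult:
  "apply_bcontfun (coefficient x v) (t * s) = apply_bcontfun (coefficient (A s x) (D s v)) t"
  by (simp add: apply_coefficient A_mult Bi_mult preadjoint)

lemma coefficient_in_C_r: "coefficient x v \<in> C_r"
  unfolding C_r_def by (simp add: coefficient_mult)

lemma translate_coefficient: "translate s (coefficient x v) = coefficient (A s x) (D s v)"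
  by (rule bcontfun_eqI) (simp add: apply_translate[OF coefficient_in_C_r] coefficient_mult)

text \<open>
  The second family of translates is the first one for the coefficient at \<open>A t x\<close> and \<open>D t v\<close>, as
  \<open>A\<close> and \<open>D\<close> are both homomorphisms.
\<close>
lemma coefficient_in_C_translates:
  assumes "\<And>x v. continuous_map euclidean \<tau> (\<lambda>s. coefficient (A s x) (D s v))"
  shows "coefficient x v \<in> C_translates \<tau>"
  unfolding C_translates_def
  using assms by (simp add: coefficient_in_C_r translate_coefficient A_mult D_mult)

text \<open>
  Here \<open>D s v\<close> depends on \<open>s\<close> only weakly continuously, and this suffices: composed with
  \<open>w \<mapsto> coefficient (A r x) w\<close>, a bounded functional \<open>\<psi>\<close> on \<open>C_r\<close> becomes a functional on the
  predual, that is, some \<open>y\<close>, and \<open>P y (D s v) = P (Bi s y) v\<close> is continuous in \<open>s\<close>.  The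
  change in \<open>A s x\<close> is controlled in norm, uniformly in the locally bounded \<open>D s v\<close>.
\<close>
lemma coefficient_in_C_weak: "coefficient x v \<in> C_weak"
  unfolding C_weak_def
proof (rule coefficient_in_C_translates)
  fix x v
  define f where "f s = coefficient (A s x) (D s v)" for s
  have fC: "f s \<in> C_r" for s unfolding f_def by (rule coefficient_in_C_r)
  have cont: "continuous_on UNIV (\<lambda>s. \<psi> (f s))"
    if \<psi>: "bounded_linear_map_on scaleR scaleR C_r \<psi>" for \<psi> :: "('s \<Rightarrow>\<^sub>C real) \<Rightarrow> real"
    unfolding continuous_on_UNIV_iff_null
  proof
    fix r
    have add: "\<psi> (coefficient x v + coefficient x' v') = \<psi> (coefficient x v) + \<psi> (coefficient x' v')"
      for x v x' v'
      using \<psi> coefficient_in_C_r unfolding bounded_linear_map_on_def linear_map_on_def by blast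
    have scale: "\<psi> (c *\<^sub>R coefficient x v) = c * \<psi> (coefficient x v)" for c x v
      using \<psi> coefficient_in_C_r unfolding bounded_linear_map_on_def linear_map_on_def by simp
    obtain K0 where K0: "\<And>g. g \<in> C_r \<Longrightarrow> norm (\<psi> g) \<le> K0 * norm g"
      using \<psi> unfolding bounded_linear_map_on_def by blast
    define K where "K = \<bar>K0\<bar> * (M * norm T1)"
    have K: "\<bar>\<psi> (coefficient x v)\<bar> \<le> K * norm x * norm v" for x v
    proof -
      have "\<bar>\<psi> (coefficient x v)\<bar> \<le> \<bar>K0\<bar> * norm (coefficient x v)"
        using K0[OF coefficient_in_C_r[of x v]] mult_right_mono[OF abs_ge_self[of K0] norm_ge_zero]
        by (metis order_trans real_norm_def)
      also have "\<dots> \<le> \<bar>K0\<bar> * (M * norm T1 * norm x * norm v)"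
        by (intro mult_left_mono norm_coefficient_le) simp
      finally show ?thesis by (simp add: K_def mult_ac)
    qed
    have "bounded_linear (\<lambda>w. \<psi> (coefficient (A r x) w))"
      by (rule bounded_linear_intro[where K = "K * norm (A r x)"])
        (use K[of "A r x"] in \<open>auto simp: coefficient_add_right coefficient_scaleR_right add scale mult_ac\<close>)
    then obtain y where y: "\<And>w. \<psi> (coefficient (A r x) w) = P y w" using represent by blast
    have "((\<lambda>s. \<psi> (coefficient (A s x - A r x) (D s v))) \<longlongrightarrow> 0) (at r)"
    proof (rule tendsto_zero_locally_bounded_mult[OF Bi_locally_bounded])
      have "((\<lambda>s. A s x - A r x) \<longlongrightarrow> 0) (at r)"
        using A_continuous[of x] unfolding continuous_on_UNIV_iff_null by blast
      then show "((\<lambda>s. (K * norm v) *\<^sub>R (A s x - A r x)) \<longlongrightarrow> 0) (at r)"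
        using tendsto_scaleR[OF tendsto_const] by fastforce
      fix s
      have "\<bar>\<psi> (coefficient (A s x - A r x) (D s v))\<bar> \<le> K * norm (A s x - A r x) * norm (D s v)"
        by (rule K)
      also have "\<dots> \<le> \<bar>K\<bar> * norm (A s x - A r x) * (norm (Bi s) * norm v)"
        by (intro mult_mono norm_D_le) auto
      finally show "norm (\<psi> (coefficient (A s x - A r x) (D s v)))
          \<le> norm (Bi s) * norm ((K * norm v) *\<^sub>R (A s x - A r x))"
        by (simp add: mult_ac abs_mult)
    qed
    moreover have "((\<lambda>s. P (Bi s y) v - P (Bi r y) v) \<longlongrightarrow> 0) (at r)"
      using bounded_linear.continuous_on[OF bounded_linear_left Bi_continuous]
      unfolding continuous_on_UNIV_iff_null by blast
    ultimately have "((\<lambda>s. \<psi> (coefficient (A s x - A r x) (D s v))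
        + (P (Bi s y) v - P (Bi r y) v)) \<longlongrightarrow> 0) (at r)"
      by (rule tendsto_add_zero)
    moreover have "\<psi> (f s) - \<psi> (f r) = \<psi> (coefficient (A s x - A r x) (D s v))
        + (P (Bi s y) v - P (Bi r y) v)" for s
    proof -
      have "\<psi> (f s) = \<psi> (coefficient ((A s x - A r x) + A r x) (D s v))" by (simp add: f_def)
      also have "\<dots> = \<psi> (coefficient (A s x - A r x) (D s v)) + P (Bi s y) v"
        unfolding coefficient_add_left by (simp add: add y preadjoint)
      finally show ?thesis by (simp add: f_def y preadjoint)
    qed
    ultimately show "((\<lambda>s. \<psi> (f s) - \<psi> (f r)) \<longlongrightarrow> 0) (at r)" by simp
  qed
  show "continuous_map euclidean (weak_topology_on C_r) (\<lambda>s. coefficient (A s x) (D s v))"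
    unfolding weak_topology_on_def f_def[symmetric]
  proof (rule continuous_on_generated_topo)
    fix W
    assume "W \<in> {{x \<in> C_r. \<phi> x \<in> U} | (\<phi> :: ('s \<Rightarrow>\<^sub>C real) \<Rightarrow> real) U.
       bounded_linear_map_on scaleR scaleR C_r \<phi> \<and> open U}"
    then obtain \<psi> :: "('s \<Rightarrow>\<^sub>C real) \<Rightarrow> real" and U
      where W: "W = {x \<in> C_r. \<psi> x \<in> U}" "bounded_linear_map_on scaleR scaleR C_r \<psi>" "open U"
      by blast
    have "f -` W = (\<lambda>s. \<psi> (f s)) -` U" using fC by (auto simp: W(1))
    then show "openin euclidean (f -` W \<inter> topspace euclidean)"
      using open_vimage[OF W(3) cont[OF W(2)]] by simp
  next
    \<comment> \<open>The zero functional makes \<open>C_r\<close> itself one of the generating sets.\<close>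
    have "bounded_linear_map_on scaleR scaleR C_r (\<lambda>_ :: 's \<Rightarrow>\<^sub>C real. 0 :: real)"
      unfolding bounded_linear_map_on_def linear_map_on_def by (auto intro: exI[of _ 0])
    then have "C_r \<subseteq> \<Union> {{x \<in> C_r. \<phi> x \<in> U} | (\<phi> :: ('s \<Rightarrow>\<^sub>C real) \<Rightarrow> real) U.
       bounded_linear_map_on scaleR scaleR C_r \<phi> \<and> open U}"
      by (intro Union_upper CollectI exI[of _ "\<lambda>_. 0"] exI[of _ UNIV]) auto
    then show "f ` topspace euclidean \<subseteq> \<Union> {{x \<in> C_r. \<phi> x \<in> U} | (\<phi> :: ('s \<Rightarrow>\<^sub>C real) \<Rightarrow> real) U.
       bounded_linear_map_on scaleR scaleR C_r \<phi> \<and> open U}"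
      using fC by blast
  qed
qed

lemma bounded_bilinear_coefficient: "bounded_bilinear coefficient"
  by (rule bounded_bilinear.intro)
    (auto simp: coefficient_add_left coefficient_add_right coefficient_scaleR_left
      coefficient_scaleR_right intro!: exI[of _ "M * norm T1"] order_trans[OF norm_coefficient_le]
      simp: mult_ac)

lemma coefficient_in_C_norm:
  assumes "continuous_on UNIV A" "continuous_on UNIV Bi"
  shows "coefficient x v \<in> C_norm"
  unfolding C_norm_def
proof (rule coefficient_in_C_translates)
  fix x v
  have "continuous_on UNIV (\<lambda>s. D s v)"
    unfolding continuous_on_UNIV_iff_null
  proof
    fix r
    have "((\<lambda>s. norm (Bi s - Bi r) * norm v) \<longlongrightarrow> 0) (at r)"
      using assms(2) unfolding continuous_on_UNIV_iff_null
      by (intro tendsto_mult_left_zero tendsto_norm_zero) blast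
    then show "((\<lambda>s. D s v - D r v) \<longlongrightarrow> 0) (at r)"
      by (rule Lim_null_comparison[rotated]) (simp add: norm_D_diff_le)
  qed
  with A_continuous[of x] have "continuous_on UNIV (\<lambda>s. coefficient (A s x) (D s v))"
    by (intro bounded_bilinear.continuous_on[OF bounded_bilinear_coefficient])
  then show "continuous_map euclidean (top_of_set C_r) (\<lambda>s. coefficient (A s x) (D s v))"
    by (auto simp: continuous_map_in_subtopology coefficient_in_C_r)
qed

text \<open>
  For fixed \<open>x\<close> the mean of the coefficients is a bounded functional of \<open>v\<close>, hence given by a point
  \<open>T x\<close> of the dual.  Invariance of the mean under translation by \<open>s\<close> is the relation
  \<open>Bi s (T (A s x)) = T x\<close>.
\<close>
lemma averaged_operator:
  assumes \<phi>: "right_invariant_mean_on F \<phi>" and F: "\<And>x v. coefficient x v \<in> F"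
  obtains T :: "'x \<Rightarrow>\<^sub>L 'y"
  where "\<And>x v. P (T x) v = \<phi> (coefficient x v)" "\<And>s x. Bi s (T (A s x)) = T x"
proof -
  have mean: "mean_on F \<phi>" using \<phi> unfolding right_invariant_mean_on_def by blast
  have add: "\<phi> (coefficient x v + coefficient x' v') = \<phi> (coefficient x v) + \<phi> (coefficient x' v')"
    for x v x' v'
    using mean F unfolding mean_on_def linear_map_on_def by blast
  have scale: "\<phi> (c *\<^sub>R coefficient x v) = c * \<phi> (coefficient x v)" for c x v
    using mean F unfolding mean_on_def linear_map_on_def by simp
  have bound: "\<bar>\<phi> (coefficient x v)\<bar> \<le> M * norm T1 * norm x * norm v" for x v
    using mean_on_abs_le[OF mean F] norm_coefficient_le by (rule order_trans)
  have "\<exists>y. \<forall>v. \<phi> (coefficient x v) = P y v" for x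
    by (rule represent, rule bounded_linear_intro[where K = "M * norm T1 * norm x"])
      (use bound[of x] in \<open>auto simp: coefficient_add_right coefficient_scaleR_right add scale mult_ac\<close>)
  then obtain T where T: "\<And>x v. \<phi> (coefficient x v) = P (T x) v" by metis
  have M: "0 \<le> M" using order_trans[OF _ uniform_bound, of 0] by simp
  have "bounded_linear T"
  proof (rule bounded_linear_intro[where K = "M * norm T1"])
    show "T (x + x') = T x + T x'" for x x'
      by (rule dual_eqI) (simp add: add_left coefficient_add_left add flip: T)
    show "T (r *\<^sub>R x) = r *\<^sub>R T x" for r x
      by (rule dual_eqI) (simp add: scaleR_left coefficient_scaleR_left scale flip: T)
    show "norm (T x) \<le> norm x * (M * norm T1)" for x
      by (rule norm_le) (use M bound[of x] in \<open>auto simp: mult_ac simp flip: T\<close>)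
  qed
  then have app: "blinfun_apply (Blinfun T) = T" by (rule bounded_linear_Blinfun_apply)
  have "Bi s (T (A s x)) = T x" for s x
  proof (rule dual_eqI)
    fix v
    have "P (Bi s (T (A s x))) v = \<phi> (coefficient (A s x) (D s v))" by (simp add: preadjoint T)
    also have "\<dots> = \<phi> (translate s (coefficient x v))" by (simp add: translate_coefficient)
    also have "\<dots> = \<phi> (coefficient x v)" using \<phi> F unfolding right_invariant_mean_on_def by blast
    finally show "P (Bi s (T (A s x))) v = P (T x) v" by (simp add: T)
  qed
  with T show ?thesis using that[of "Blinfun T"] by (simp add: app)
qed

end


section \<open>Duality over the scalar field\<close>

lemma eq_zero_if_multiples_orthogonal:
  fixes a e :: "'k::{real_normed_field,euclidean_space}"
  assumes e: "norm e = 1" and orth: "\<And>b. b \<in> Basis \<Longrightarrow> (b * a) \<bullet> e = 0"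
  shows "a = 0"
proof (rule ccontr)
  assume a: "a \<noteq> 0"
  have "(c * a) \<bullet> e = 0" for c
  proof -
    have "c * a = (\<Sum>b\<in>Basis. (c \<bullet> b) *\<^sub>R (b * a))"
      by (subst euclidean_representation[of c, symmetric]) (simp add: sum_distrib_right)
    then show ?thesis by (simp add: inner_sum_left orth)
  qed
  from this[of "e / a"] a e show False by (simp add: dot_square_norm)
qed

text \<open>
  Both this bound and the previous lemma are tested at the scalar \<open>e / a\<close>, whose product with \<open>a\<close>
  has component \<open>e \<bullet> e = 1\<close>.
\<close>
lemma norm_le_if_multiples_bounded:
  fixes a e :: "'k::{real_normed_field,euclidean_space}"
  assumes e: "norm e = 1" and M: "0 \<le> M" and le: "\<And>c. \<bar>(c * a) \<bullet> e\<bar> \<le> M * norm c"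
  shows "norm a \<le> M"
proof (cases "a = 0")
  case False
  with le[of "e / a"] e show ?thesis
    by (simp add: dot_square_norm norm_divide field_simps)
qed (use M in simp)

text \<open>
  The real bilinear form \<open>(c, a) \<mapsto> (c * a) \<bullet> e\<close> is nondegenerate because the scalars form a field,
  so in finite dimension it represents every real functional.
\<close>
lemma scalar_functional_representation:
  fixes e :: "'k::{real_normed_field,euclidean_space}"
  assumes e: "norm e = 1" and m: "linear (m :: 'k \<Rightarrow> real)"
  shows "\<exists>a. \<forall>c. m c = (c * a) \<bullet> e"
proof -
  define L where "L a = (\<Sum>b\<in>Basis. ((b * a) \<bullet> e) *\<^sub>R b)" for a :: 'k
  have L_inner: "L a \<bullet> b = (b * a) \<bullet> e" if "b \<in> Basis" for a b
    unfolding L_def using that by simp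
  have "linear L"
    by (rule linearI)
      (simp_all add: L_def distrib_left inner_add_left scaleR_add_left sum.distrib
        scaleR_sum_right)
  moreover have "inj L"
  proof (rule linear_injective_0[THEN iffD2, OF \<open>linear L\<close>, rule_format])
    fix a assume "L a = 0"
    then show "a = 0"
      by (intro eq_zero_if_multiples_orthogonal[OF e]) (simp flip: L_inner)
  qed
  ultimately have "surj L" by (rule linear_injective_imp_surjective) simp
  then obtain a where a: "L a = (\<Sum>b\<in>Basis. m b *\<^sub>R b)" by (metis surjD)
  have ab: "m b = (b * a) \<bullet> e" if "b \<in> Basis" for b
    using L_inner[OF that, of a] that by (simp add: a)
  have "m c = (c * a) \<bullet> e" for c
  proof (rule linear_eq_on[OF m])
    show "linear (\<lambda>c. (c * a) \<bullet> e)" by (rule linearI) (simp_all add: distrib_right inner_add_left)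
    show "c \<in> span Basis" by simp
  qed (rule ab)
  then show ?thesis by blast
qed

lemma bounded_operators_iff:
  assumes "banach_space_over scaleX" "vector_space scaleY"
  shows "T \<in> bounded_operators scaleX scaleY \<longleftrightarrow>
    (\<forall>c x. blinfun_apply T (scaleX c x) = scaleY c (blinfun_apply T x))"
  using assms
  unfolding bounded_operators_def banach_space_over_def Vector_Spaces.linear_def
    module_hom_def module_hom_axioms_def module_iff_vector_space
  by (auto simp: blinfun.add_right)

text \<open>
  For complex scalars and \<open>e = 1\<close> this is the usual recovery of a complex functional from its
  real part.  In general \<open>f v\<close> is the scalar representing \<open>c \<mapsto> \<psi> (c v)\<close>.
\<close>
lemma real_functional_extends_to_scalars:
  fixes e :: "'k::{real_normed_field,euclidean_space}"
    and scaleV :: "'k \<Rightarrow> 'v::banach \<Rightarrow> 'v"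
  assumes e: "norm e = 1" and V: "banach_space_over scaleV" and \<psi>: "bounded_linear \<psi>"
  shows "\<exists>f\<in>bounded_operators scaleV (*). \<forall>v. \<psi> v = blinfun_apply f v \<bullet> e"
proof -
  interpret V: banach_space_over scaleV by (rule V)
  have scaleR_V: "scaleV (r *\<^sub>R c) v = r *\<^sub>R scaleV c v" for r c v
    by (simp add: V.scale_of_real[symmetric] scaleR_conv_of_real)
  have "\<exists>a. \<forall>c. \<psi> (scaleV c v) = (c * a) \<bullet> e" for v
  proof (rule scalar_functional_representation[OF e], rule linearI)
    show "\<psi> (scaleV (c + d) v) = \<psi> (scaleV c v) + \<psi> (scaleV d v)" for c d
      by (simp add: V.scale_left_distrib linear_simps(1)[OF \<psi>])
    show "\<psi> (scaleV (r *\<^sub>R c) v) = r *\<^sub>R \<psi> (scaleV c v)" for r c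
      by (simp add: scaleR_V linear_simps(5)[OF \<psi>])
  qed
  then obtain f where f: "\<And>v c. \<psi> (scaleV c v) = (c * f v) \<bullet> e" by metis
  have eq: "a = b" if "\<And>c. (c * a) \<bullet> e = (c * b) \<bullet> e" for a b
    using eq_zero_if_multiples_orthogonal[OF e, of "a - b"] that
    by (simp add: right_diff_distrib inner_diff_left)
  have f_scale: "f (scaleV d v) = d * f v" for d v
    by (rule eq) (simp add: mult.assoc[symmetric] flip: f)
  obtain K where K: "0 < K" "\<And>v. norm (\<psi> v) \<le> norm v * K"
    using bounded_linear.pos_bounded[OF \<psi>] by blast
  have "bounded_linear f"
  proof (rule bounded_linear_intro[where K = K])
    show "f (v + w) = f v + f w" for v w
      by (rule eq) (simp add: distrib_left inner_add_left V.scale_right_distrib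
          linear_simps(1)[OF \<psi>] flip: f)
    show "f (r *\<^sub>R v) = r *\<^sub>R f v" for r v
      using f_scale[of "of_real r" v] by (simp add: V.scale_of_real scaleR_conv_of_real)
    show "norm (f v) \<le> norm v * K" for v
    proof (rule norm_le_if_multiples_bounded[OF e])
      show "\<bar>(c * f v) \<bullet> e\<bar> \<le> norm v * K * norm c" for c
        using K(2)[of "scaleV c v"] by (simp add: V.norm_scale f mult_ac)
    qed (use K(1) in simp)
  qed
  then have app: "blinfun_apply (Blinfun f) = f" by (rule bounded_linear_Blinfun_apply)
  have "Blinfun f \<in> bounded_operators scaleV (*)"
    unfolding bounded_operators_iff[OF V vector_space_over_itself.vector_space_axioms]
    by (simp add: app f_scale)
  moreover have "\<psi> v = blinfun_apply (Blinfun f) v \<bullet> e" for v using f[of 1 v] by (simp add: app)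
  ultimately show ?thesis by blast
qed

text \<open>
  The scalar-valued pairing between \<open>Y\<close> and its predual, reduced to one real component.  For \<open>e\<close>
  of norm \<open>1\<close> nothing is lost: multiplying \<open>v\<close> by scalars recovers the other components.
\<close>
definition real_pairing ::
  "('y \<Rightarrow> 'v::real_normed_vector \<Rightarrow>\<^sub>L 'k::euclidean_space) \<Rightarrow> 'k \<Rightarrow> 'y \<Rightarrow> 'v \<Rightarrow> real"
  where "real_pairing J e y v = blinfun_apply (J y) v \<bullet> e"

locale scalar_duality =
  fixes scaleY :: "'k::{real_normed_field,euclidean_space} \<Rightarrow> 'y::banach \<Rightarrow> 'y"
    and scaleV :: "'k \<Rightarrow> 'v::banach \<Rightarrow> 'v"
    and J :: "'y \<Rightarrow> ('v \<Rightarrow>\<^sub>L 'k)" and e :: 'k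
  assumes Y: "banach_space_over scaleY"
    and J: "dual_identification scaleY scaleV J" and e: "norm e = 1"
begin

lemma predual_banach: "banach_space_over scaleV" using J unfolding dual_identification_def by blast

lemma J_add: "J (x + y) = J x + J y" using J unfolding dual_identification_def by blast

lemma J_norm: "norm (J y) = norm y" using J unfolding dual_identification_def by blast

lemma J_range: "range J = bounded_operators scaleV (*)"
  using J unfolding dual_identification_def by blast

lemma J_scaleY: "blinfun_apply (J (scaleY c y)) v = c * blinfun_apply (J y) v"
  using J unfolding dual_identification_def by blast

lemma J_scaleV: "blinfun_apply (J y) (scaleV c v) = c * blinfun_apply (J y) v"
  using J_range bounded_operators_iff[OF predual_banach vector_space_over_itself.vector_space_axioms, of "J y"]
  by blast

lemma J_scaleR: "J (r *\<^sub>R y) = r *\<^sub>R J y"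
  by (rule blinfun_eqI)
    (metis J_scaleY Y banach_space_over.scale_of_real blinfun.scaleR_left scaleR_conv_of_real)

lemma real_pairing_scale: "real_pairing J e (scaleY c y) v = real_pairing J e y (scaleV c v)"
  by (simp add: real_pairing_def J_scaleY J_scaleV)

lemma real_duality_real_pairing: "real_duality (real_pairing J e)"
proof
  have abs_le: "\<bar>real_pairing J e y v\<bar> \<le> norm y * norm v" for y v
    using Cauchy_Schwarz_ineq2[of "J y v" e] norm_blinfun[of "J y" v]
    by (simp add: real_pairing_def e J_norm)
  show "\<exists>K. \<forall>a b. norm (real_pairing J e a b) \<le> norm a * norm b * K"
    using abs_le by (intro exI[of _ 1]) simp
  show "\<bar>real_pairing J e y v\<bar> \<le> norm y * norm v" for y v by (rule abs_le)
  show "\<exists>y. \<forall>v. \<psi> v = real_pairing J e y v" if \<psi>: "bounded_linear \<psi>" for \<psi>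
    using real_functional_extends_to_scalars[OF e predual_banach \<psi>] unfolding J_range[symmetric]
    by (auto simp: real_pairing_def)
  show "norm y \<le> M" if M: "0 \<le> M" and le: "\<And>v. \<bar>real_pairing J e y v\<bar> \<le> M * norm v" for M y
    unfolding J_norm[symmetric]
  proof (rule norm_blinfun_bound[OF M])
    fix v
    show "norm (J y v) \<le> M * norm v"
    proof (rule norm_le_if_multiples_bounded[OF e])
      show "\<bar>(c * blinfun_apply (J y) v) \<bullet> e\<bar> \<le> M * norm v * norm c" for c
        using le[of "scaleV c v"]
        by (simp add: real_pairing_def J_scaleV banach_space_over.norm_scale[OF predual_banach] mult_ac)
    qed (use M in simp)
  qed
qed (simp_all add: real_pairing_def J_add J_scaleR blinfun.add_left blinfun.add_right
    blinfun.scaleR_left blinfun.scaleR_right inner_add_left)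

sublocale real_duality "real_pairing J e" by (rule real_duality_real_pairing)

text \<open>
  A weak* neighbourhood of \<open>0\<close> contains every \<open>y\<close> for which \<open>J y\<close> vanishes at certain finitely
  many points.  Vanishing of the scalar \<open>J y w\<close> means vanishing of the real pairing of \<open>y\<close> with all
  \<open>scaleV b w\<close>, where \<open>b\<close> runs through the finite basis of the scalar field.
\<close>
lemma weak_star_continuous_imp_small:
  assumes C: "continuous_map (subtopology (weak_star_topology J) (cball 0 1))
      (weak_star_topology J) B" and B: "B 0 = 0"
  shows "weak_star_small (\<lambda>y. real_pairing J e (B y) v)"
proof -
  have J0: "J 0 = 0" using J_scaleR[of 0 0] by simp
  have openin_iff: "openin (weak_star_topology J) W \<longleftrightarrow> (\<exists>H. open H \<and> W = {y. blinfun_apply (J y) \<in> H})" for W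
    unfolding weak_star_topology_def strong_operator_topology_def openin_pullback_topology
    by (auto simp: vimage_def)
  show ?thesis
    unfolding weak_star_small_def
  proof (intro allI impI)
    fix \<epsilon> :: real assume \<epsilon>: "0 < \<epsilon>"
    have "open {g :: 'v \<Rightarrow> 'k. \<bar>g v \<bullet> e\<bar> < \<epsilon>}"
      by (intro open_Collect_less continuous_intros) auto
    then have "openin (weak_star_topology J) {y. \<bar>real_pairing J e y v\<bar> < \<epsilon>}"
      unfolding openin_iff real_pairing_def by blast
    then have "openin (subtopology (weak_star_topology J) (cball 0 1))
        {y \<in> topspace (subtopology (weak_star_topology J) (cball 0 1)).
          B y \<in> {y. \<bar>real_pairing J e y v\<bar> < \<epsilon>}}"
      using C unfolding continuous_map_def by blast
    moreover have "topspace (weak_star_topology J) = UNIV"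
      using openin_iff[of UNIV] openin_subset by blast
    ultimately obtain H :: "('v \<Rightarrow> 'k) set" where H: "open H"
      "{y \<in> cball 0 1. \<bar>real_pairing J e (B y) v\<bar> < \<epsilon>} = {y. blinfun_apply (J y) \<in> H} \<inter> cball 0 1"
      unfolding openin_subtopology openin_iff by auto
    have "0 \<in> {y \<in> cball 0 1. \<bar>real_pairing J e (B y) v\<bar> < \<epsilon>}"
      using \<epsilon> by (simp add: B zero_left)
    then have "blinfun_apply (J 0) \<in> H" unfolding H(2) by simp
    then obtain X where X: "blinfun_apply (J 0) \<in> (\<Pi>\<^sub>E i\<in>UNIV. X i)" "finite {i. X i \<noteq> UNIV}"
      "(\<Pi>\<^sub>E i\<in>UNIV. X i) \<subseteq> H"
      using H(1) product_topology_open_contains_basis[of "\<lambda>_. euclidean" UNIV H "blinfun_apply (J 0)"]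
      unfolding euclidean_product_topology by auto
    define F where "F = (\<lambda>(b, w). scaleV b w) ` (Basis \<times> {i. X i \<noteq> UNIV})"
    have "\<bar>real_pairing J e (B y) v\<bar> \<le> \<epsilon>"
      if y: "norm y \<le> 1" "\<forall>w\<in>F. real_pairing J e y w = 0" for y
    proof -
      have "blinfun_apply (J y) w = 0" if "X w \<noteq> UNIV" for w
        by (rule eq_zero_if_multiples_orthogonal[OF e])
          (use y(2) that in \<open>auto simp: F_def real_pairing_def J_scaleV\<close>)
      then have "blinfun_apply (J y) w \<in> X w" for w
        using X(1) by (cases "X w = UNIV") (auto simp: J0 PiE_iff)
      then have "blinfun_apply (J y) \<in> H" using X(3) by (auto simp: PiE_iff)
      then have "y \<in> {y \<in> cball 0 1. \<bar>real_pairing J e (B y) v\<bar> < \<epsilon>}"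
        unfolding H(2) using y(1) by simp
      then show ?thesis by simp
    qed
    moreover have "finite F" unfolding F_def using X(2) by simp
    ultimately show "\<exists>F. finite F \<and> (\<forall>y. norm y \<le> 1 \<longrightarrow> (\<forall>w\<in>F. real_pairing J e y w = 0) \<longrightarrow>
        \<bar>real_pairing J e (B y) v\<bar> \<le> \<epsilon>)" by blast
  qed
qed

end


section \<open>Intertwining extensions\<close>

lemma isomorphism_inverse:
  fixes B :: "'y::real_normed_vector \<Rightarrow>\<^sub>L 'y"
  assumes "isomorphism B"
  obtains Bi :: "'y \<Rightarrow>\<^sub>L 'y"
  where "\<And>y. Bi (B y) = y" "\<And>y. B (Bi y) = y" "norm Bi = inverse_norm B"
proof (rule that[of "Blinfun (inv (blinfun_apply B))"])
  have app: "blinfun_apply (Blinfun (inv (blinfun_apply B))) = inv (blinfun_apply B)"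
    using assms unfolding isomorphism_def by (simp add: bounded_linear_Blinfun_apply)
  have bij: "bij (blinfun_apply B)" using assms unfolding isomorphism_def by blast
  show "Blinfun (inv (blinfun_apply B)) (B y) = y" for y
    unfolding app by (rule inv_f_f[OF bij_is_inj[OF bij]])
  show "B (Blinfun (inv (blinfun_apply B)) y) = y" for y
    unfolding app by (rule surj_f_inv_f[OF bij_is_surj[OF bij]])
  show "norm (Blinfun (inv (blinfun_apply B))) = inverse_norm B"
    by (simp add: norm_blinfun.rep_eq app inverse_norm_def)
qed

text \<open>
  Both continuity lemmas use \<open>B\<^sub>s\<^sup>-\<^sup>1 - B\<^sub>r\<^sup>-\<^sup>1 = - B\<^sub>s\<^sup>-\<^sup>1 (B\<^sub>s - B\<^sub>r) B\<^sub>r\<^sup>-\<^sup>1\<close>, where the first factor is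
  locally bounded and the last does not depend on \<open>s\<close>.
\<close>
lemma strongly_continuous_inverse:
  fixes B Bi :: "'s::topological_space \<Rightarrow> 'y::real_normed_vector \<Rightarrow>\<^sub>L 'y"
  assumes inv: "\<And>s y. Bi s (B s y) = y" "\<And>s y. B s (Bi s y) = y"
    and loc: "locally_bounded (\<lambda>s. norm (Bi s))"
    and cont: "\<And>y. continuous_on UNIV (\<lambda>s. B s y)"
  shows "continuous_on UNIV (\<lambda>s. Bi s y)"
  unfolding continuous_on_UNIV_iff_null
proof
  fix r
  have "((\<lambda>s. B s (Bi r y) - B r (Bi r y)) \<longlongrightarrow> 0) (at r)"
    using cont[of "Bi r y"] unfolding continuous_on_UNIV_iff_null by blast
  then show "((\<lambda>s. Bi s y - Bi r y) \<longlongrightarrow> 0) (at r)"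
  proof (rule tendsto_zero_locally_bounded_mult[OF loc])
    fix s
    have "Bi s y - Bi r y = - Bi s (B s (Bi r y) - B r (Bi r y))"
      by (simp add: inv blinfun.diff_right)
    then show "norm (Bi s y - Bi r y) \<le> norm (Bi s) * norm (B s (Bi r y) - B r (Bi r y))"
      by (metis norm_minus_cancel norm_blinfun)
  qed
qed

lemma norm_continuous_inverse:
  fixes B Bi :: "'s::topological_space \<Rightarrow> 'y::real_normed_vector \<Rightarrow>\<^sub>L 'y"
  assumes inv: "\<And>s y. Bi s (B s y) = y" "\<And>s y. B s (Bi s y) = y"
    and loc: "locally_bounded (\<lambda>s. norm (Bi s))"
    and cont: "continuous_on UNIV B"
  shows "continuous_on UNIV Bi"
  unfolding continuous_on_UNIV_iff_null
proof
  fix r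
  have "((\<lambda>s. B s - B r) \<longlongrightarrow> 0) (at r)"
    using cont unfolding continuous_on_UNIV_iff_null by blast
  then have "((\<lambda>s. (B s - B r) o\<^sub>L Bi r) \<longlongrightarrow> 0) (at r)"
    by (rule bounded_linear.tendsto_zero[OF bounded_bilinear.bounded_linear_left[OF bounded_bilinear_blinfun_compose]])
  then show "((\<lambda>s. Bi s - Bi r) \<longlongrightarrow> 0) (at r)"
  proof (rule tendsto_zero_locally_bounded_mult[OF loc])
    fix s
    have "Bi s - Bi r = - (Bi s o\<^sub>L ((B s - B r) o\<^sub>L Bi r))"
      by (rule blinfun_eqI) (simp add: inv blinfun.diff_left blinfun.minus_left blinfun.diff_right)
    then show "norm (Bi s - Bi r) \<le> norm (Bi s) * norm ((B s - B r) o\<^sub>L Bi r)"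
      by (metis norm_minus_cancel norm_blinfun_compose)
  qed
qed

theorem corollary4p11:
  fixes scaleX :: "'k::{real_normed_field,euclidean_space} \<Rightarrow> 'x::banach \<Rightarrow> 'x"
    and scaleY :: "'k \<Rightarrow> 'y::banach \<Rightarrow> 'y"
    and scaleV :: "'k \<Rightarrow> 'v::banach \<Rightarrow> 'v"
    and J :: "'y \<Rightarrow> ('v \<Rightarrow>\<^sub>L 'k)"
    and A :: "'s::{semigroup_mult,topological_space} \<Rightarrow> ('x \<Rightarrow>\<^sub>L 'x)"
    and B :: "'s \<Rightarrow> ('y \<Rightarrow>\<^sub>L 'y)"
    and E :: "'x set"
    and T0 :: "'x \<Rightarrow> 'y"
  assumes X: "banach_space_over scaleX" and Y: "banach_space_over scaleY"
    and A_hom: "operator_homomorphism scaleX A" and B_hom: "operator_homomorphism scaleY B"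
    and E: "closed E" "module.subspace scaleX E"
    and T0: "bounded_linear_map_on scaleX scaleY E T0"
    and i0: "(strongly_right_amenable TYPE('s) \<and>
                continuous_map euclidean strong_operator_topology A \<and>
                continuous_map euclidean strong_operator_topology B) \<or>
             (weakly_right_amenable TYPE('s) \<and>
                continuous_on UNIV A \<and> continuous_on UNIV B)"
    and i1: "\<And>s. blinfun_apply (A s) ` E \<subseteq> E" "\<And>s. isomorphism (B s)"
    and i2: "dual_identification scaleY scaleV J"
    and i3: "\<And>s. continuous_map (subtopology (weak_star_topology J) (cball 0 1))
                    (weak_star_topology J) (blinfun_apply (B s))"
    and i4: "locally_bounded (\<lambda>s. inverse_norm (B s))"
    and i5: "\<And>s x. x \<in> E \<Longrightarrow> blinfun_apply (B s) (T0 x) = T0 (blinfun_apply (A s) x)"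
    and bdd: "bdd_above (range (\<lambda>s. inverse_norm (B s) * norm (A s)))"
  shows "(\<exists>T \<in> bounded_operators scaleX scaleY.
            (\<forall>x\<in>E. blinfun_apply T x = T0 x) \<and> (\<forall>s. B s o\<^sub>L T = T o\<^sub>L A s)) \<longleftrightarrow>
         (\<exists>T \<in> bounded_operators scaleX scaleY. \<forall>x\<in>E. blinfun_apply T x = T0 x)"
proof
  assume "\<exists>T \<in> bounded_operators scaleX scaleY. \<forall>x\<in>E. blinfun_apply T x = T0 x"
  then obtain T1 where T1: "T1 \<in> bounded_operators scaleX scaleY" "\<And>x. x \<in> E \<Longrightarrow> T1 x = T0 x"
    by blast
  obtain e :: 'k where "e \<in> Basis" using nonempty_Basis by blast
  then have e: "norm e = 1" by simp
  have vsX: "vector_space scaleX" and vsY: "vector_space scaleY"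
    using X Y unfolding banach_space_over_def by blast+
  interpret scalar_duality scaleY scaleV J e
    by (rule scalar_duality.intro[OF Y i2 e])
  let ?P = "real_pairing J e"
  have A_mult: "A (s * t) = A s o\<^sub>L A t" and B_mult: "B (s * t) = B s o\<^sub>L B t" for s t
    using A_hom B_hom unfolding operator_homomorphism_def by blast+
  have A_scale: "A s (scaleX c x) = scaleX c (A s x)" for s c x
    using A_hom unfolding operator_homomorphism_def bounded_operators_iff[OF X vsX] by blast
  have B_scale: "B s (scaleY c y) = scaleY c (B s y)" for s c y
    using B_hom unfolding operator_homomorphism_def bounded_operators_iff[OF Y vsY] by blast
  have T1_scale: "T1 (scaleX c x) = scaleY c (T1 x)" for c x
    using T1(1) unfolding bounded_operators_iff[OF X vsY] by blast

  have "\<forall>s. \<exists>C. (\<forall>y. blinfun_apply C (B s y) = y) \<and> (\<forall>y. B s (C y) = y) \<and> norm C = inverse_norm (B s)"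
    using isomorphism_inverse[OF i1(2)] by metis
  then obtain Bi :: "'s \<Rightarrow> 'y \<Rightarrow>\<^sub>L 'y" where inv: "\<And>s y. Bi s (B s y) = y" "\<And>s y. B s (Bi s y) = y"
    and norm_Bi: "\<And>s. norm (Bi s) = inverse_norm (B s)"
    by metis
  have Bi_mult: "Bi (s * t) = Bi t o\<^sub>L Bi s" for s t
  proof (rule blinfun_eqI)
    fix y
    have "Bi (s * t) (B (s * t) (Bi t (Bi s y))) = Bi t (Bi s y)" by (rule inv)
    then show "Bi (s * t) y = (Bi t o\<^sub>L Bi s) y" by (simp add: B_mult inv)
  qed
  have Bi_scale: "Bi s (scaleY c y) = scaleY c (Bi s y)" for s c y
    by (metis B_scale inv)
  have loc: "locally_bounded (\<lambda>s. norm (Bi s))" using i4 by (simp add: norm_Bi)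

  have "\<exists>D. \<forall>y v. ?P (Bi s y) v = ?P y (D v)" for s
  proof -
    have "weak_star_small (\<lambda>y. ?P (B s y) v)" for v
      by (rule weak_star_continuous_imp_small[OF i3]) (simp add: blinfun.zero_right)
    then show ?thesis
      using preadjoint_inverse_exists[OF blinfun.bounded_linear_right blinfun.bounded_linear_right inv(1) inv(2), of s]
      by metis
  qed
  then obtain D where D: "\<And>s y v. ?P (Bi s y) v = ?P y (D s v)" by metis
  obtain M where M: "\<And>s. norm (Bi s) * norm (A s) \<le> M"
    using bdd unfolding bdd_above_def by (auto simp: norm_Bi)
  have strong: "continuous_on UNIV (\<lambda>s. A s x)" "continuous_on UNIV (\<lambda>s. B s y)" for x y
    using i0 by (auto simp: continuous_on_strong_operator_topo_iff_coordinatewise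
        intro: bounded_linear.continuous_on[OF blinfun.bounded_linear_left])
  interpret averaging ?P A Bi D T1 M
    by unfold_locales
      (fact A_mult Bi_mult D M loc strong(1) strongly_continuous_inverse[OF inv loc strong(2)])+

  obtain F \<phi> where \<phi>: "right_invariant_mean_on F \<phi>" and F: "\<And>x v. coefficient x v \<in> F"
    using i0
  proof
    assume "strongly_right_amenable TYPE('s) \<and>
      continuous_map euclidean strong_operator_topology A \<and>
      continuous_map euclidean strong_operator_topology B"
    then show thesis
      using that coefficient_in_C_weak unfolding strongly_right_amenable_def by blast
  next
    assume *: "weakly_right_amenable TYPE('s) \<and> continuous_on UNIV A \<and> continuous_on UNIV B"
    then have "continuous_on UNIV Bi" using norm_continuous_inverse[OF inv loc] by blast
    with * show thesis
      using that coefficient_in_C_norm unfolding weakly_right_amenable_def by blast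
  qed
  obtain T :: "'x \<Rightarrow>\<^sub>L 'y"
    where T: "\<And>x v. ?P (T x) v = \<phi> (coefficient x v)" "\<And>s x. Bi s (T (A s x)) = T x"
    using averaged_operator[OF \<phi> F] by blast

  have "T \<in> bounded_operators scaleX scaleY"
    unfolding bounded_operators_iff[OF X vsY]
  proof (intro allI, rule dual_eqI)
    fix c x v
    \<comment> \<open>A scalar passes through all operators and from the dual to the predual.\<close>
    have "coefficient (scaleX c x) v = coefficient x (scaleV c v)"
      by (rule bcontfun_eqI) (simp add: apply_coefficient A_scale T1_scale Bi_scale real_pairing_scale)
    then show "?P (T (scaleX c x)) v = ?P (scaleY c (T x)) v"
      by (simp add: real_pairing_scale T(1))
  qed
  moreover have "T x = T0 x" if x: "x \<in> E" for x
  proof (rule dual_eqI)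
    fix v
    \<comment> \<open>On \<open>E\<close> the operator \<open>T1\<close> already intertwines, so nothing changes under conjugation.\<close>
    have "apply_bcontfun (coefficient x v) t = ?P (T0 x) v" for t
    proof -
      have "A t x \<in> E" using i1(1) x by blast
      then have "T1 (A t x) = B t (T0 x)" using T1(2) i5[OF x] by simp
      then show ?thesis by (simp add: apply_coefficient inv)
    qed
    then show "?P (T x) v = ?P (T0 x) v"
      unfolding T(1) using mean_on_constant \<phi> F unfolding right_invariant_mean_on_def by blast
  qed
  moreover have "B s o\<^sub>L T = T o\<^sub>L A s" for s
    by (rule blinfun_eqI) (metis T(2) blinfun_apply_blinfun_compose inv(2))
  ultimately show "\<exists>T \<in> bounded_operators scaleX scaleY.
      (\<forall>x\<in>E. blinfun_apply T x = T0 x) \<and> (\<forall>s. B s o\<^sub>L T = T o\<^sub>L A s)" by blast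
qed blast

end
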